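(* Let $D_{\mathcal X}=\mathcal N(\mathbf 0,\boldsymbol\Sigma_{D_{\mathcal X}})$ with $\boldsymbol\Sigma_{D_{\mathcal X}}$ positive definite, and let $\mathbf x_1,\dots,\mathbf x_{2d+2}$ be i.i.d. from $D_{\mathcal X}$. Define, for $i=1,\dots,d$, $\widetilde{\mathbf x}_i=\Big(\sum_{j=d+1}^{2d+2}\mathbf x_j\mathbf x_j^\top\Big)^{1/2}\Big(\sum_{j=1}^{d}\mathbf x_j\mathbf x_j^\top\Big)^{-1/2}\mathbf x_i$. Then $(\widetilde{\mathbf x}_1,\dots,\widetilde{\mathbf x}_d)\sim\mathrm{VS}_{D_{\mathcal X}}^d$.
   Context: For a positive definite matrix $\mathbf A$, $\mathbf A^{1/2}$ denotes the unique lower triangular matrix with positive diagonal entries such that $\mathbf A^{1/2}(\mathbf A^{1/2})^\top=\mathbf A$ (Cholesky factor), and $\mathbf A^{-1/2}:=(\mathbf A^{1/2})^{-1}$. $\mathrm{VS}_{D_{\mathcal X}}^d$ is the probability measure on $(\mathbb R^d)^d$ given by $\mathrm{VS}_{D_{\mathcal X}}^d(A)=\mathbb E_{D_{\mathcal X}^d}[\mathbf 1_A\det(\sum_{i=1}^d\mathbf x_i\mathbf x_i^\top)]/\big(d!\det(\boldsymbol\Sigma_{D_{\mathcal X}})\big)$, where $D_{\mathcal X}^d$ is the law of $d$ i.i.d. draws from $D_{\mathcal X}$. *)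

theory Defs
  imports "HOL-Probability.Probability"
begin

text \<open>Dimension d = CARD('d); coordinates indexed by a finite linearly ordered type 'd
  (the order is needed to speak of lower triangular matrices).\<close>

definition pos_def_mat :: "real^'n^'n \<Rightarrow> bool" where
  "pos_def_mat A \<longleftrightarrow> transpose A = A \<and> (\<forall>x. x \<noteq> 0 \<longrightarrow> x \<bullet> (A *v x) > 0)"

definition lower_tri :: "real^'n::{finite,linorder}^'n::{finite,linorder} \<Rightarrow> bool" where
  "lower_tri L \<longleftrightarrow> (\<forall>i j. i < j \<longrightarrow> L $ i $ j = 0)"

text \<open>Cholesky factor A^{1/2}: the unique lower triangular matrix with positive diagonal
  such that L L^T = A (fixed to 0 outside the positive definite matrices).\<close>
definition chol :: "real^'n::{finite,linorder}^'n::{finite,linorder} \<Rightarrow> real^'n::{finite,linorder}^'n::{finite,linorder}" where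
  "chol A = (if pos_def_mat A then
     (THE L. lower_tri L \<and> (\<forall>i. L $ i $ i > 0) \<and> L ** transpose L = A) else 0)"

definition chol_inv :: "real^'n::{finite,linorder}^'n::{finite,linorder} \<Rightarrow> real^'n::{finite,linorder}^'n::{finite,linorder}" where
  "chol_inv A = (if pos_def_mat A then matrix_inv (chol A) else 0)"

definition outer :: "real^'n \<Rightarrow> real^'n^'n" where
  "outer x = (\<chi> i j. x $ i * x $ j)"

definition gauss_density :: "real^'n^'n \<Rightarrow> real^'n \<Rightarrow> real" where
  "gauss_density S x =
     exp (- (x \<bullet> (matrix_inv S *v x)) / 2) / sqrt ((2 * pi) ^ CARD('n) * det S)"

definition gaussian :: "real^'n^'n \<Rightarrow> (real^'n) measure" where
  "gaussian S = density lborel (\<lambda>x. ennreal (gauss_density S x))"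

definition VS :: "(real^'n) measure \<Rightarrow> real^'n^'n \<Rightarrow> (nat \<Rightarrow> real^'n) measure" where
  "VS D S = density (PiM {..<CARD('n)} (\<lambda>_. D))
     (\<lambda>x. ennreal (det (\<Sum>i<CARD('n). outer (x i)) / (fact (CARD('n)) * det S)))"

end

theory Submission
  imports Defs
begin

text \<open>
  Let \<open>d = CARD('d)\<close>, let \<open>X\<close> be the square matrix with columns \<open>x\<^sub>1, \<dots>, x\<^sub>d\<close> and \<open>W\<close> the Gram
  matrix of the remaining \<open>d + 2\<close> vectors; put \<open>Q(X) = (X X\<^sup>T)\<^sup>-\<^sup>1\<^sup>/\<^sup>2 X\<close>, so that \<open>W\<^sup>1\<^sup>/\<^sup>2 Q(X)\<close> is the
  matrix whose law is sought.

  The Gaussian density of \<open>X\<close> is a function of \<open>X X\<^sup>T\<close>, and \<open>X \<mapsto> X U\<close> preserves Lebesgue measure for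
  orthogonal \<open>U\<close>. Hence \<open>Q(X)\<close> is independent of \<open>X X\<^sup>T\<close>, also after reweighting by a function of
  \<open>X X\<^sup>T\<close> such as the determinant, and it suffices to compare the law of \<open>W\<close> with that of \<open>X X\<^sup>T\<close>
  under volume sampling.

  Lebesgue measure on \<open>d \<times> n\<close> matrices \<open>Y\<close> is multiplied by a power of \<open>\<bar>det A\<bar>\<close> under \<open>Y \<mapsto> A Y\<close>.
  Up to a factor there is only one measure on positive definite matrices that is invariant under
  congruence, so the images of Lebesgue measure under \<open>Y \<mapsto> Y Y\<^sup>T\<close> for \<open>n = d + 2\<close> and for \<open>n = d\<close> differ
  by the density \<open>det (X X\<^sup>T)\<close> and a constant. The constant is determined by
  \<open>E det (X X\<^sup>T) = d! det S\<close>.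
\<close>

subsection \<open>Measurability of matrix operations\<close>

type_synonym 'n sqmat = "((real, 'n) vec, 'n) vec"

lemma borel_measurable_vec_nth [measurable (raw)]:
  fixes f :: "'a \<Rightarrow> 'b::topological_space^'n"
  assumes "f \<in> borel_measurable M"
  shows "(\<lambda>x. f x $ i) \<in> borel_measurable M"
proof -
  have "(\<lambda>v::'b^'n. v $ i) \<in> borel_measurable borel"
    by (intro borel_measurable_continuous_onI continuous_intros)
  from measurable_compose[OF assms this] show ?thesis .
qed

lemma borel_measurable_vec_lambda [measurable (raw)]:
  fixes f :: "'n::finite \<Rightarrow> 'a \<Rightarrow> 'b::euclidean_space"
  assumes "\<And>i. f i \<in> borel_measurable M"
  shows "(\<lambda>x. \<chi> i. f i x) \<in> borel_measurable M"
  using assms by (subst borel_measurable_euclidean_space) (auto simp: Basis_vec_def inner_axis)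

lemma borel_measurable_matrix_mult [measurable (raw)]:
  fixes f :: "'a \<Rightarrow> real^'n^'m" and g :: "'a \<Rightarrow> real^'k^'n"
  assumes [measurable]: "f \<in> borel_measurable M" "g \<in> borel_measurable M"
  shows "(\<lambda>x. f x ** g x) \<in> borel_measurable M"
  unfolding matrix_matrix_mult_def by measurable

lemma borel_measurable_matrix_vector_mult [measurable (raw)]:
  fixes f :: "'a \<Rightarrow> real^'n^'m" and g :: "'a \<Rightarrow> real^'n"
  assumes [measurable]: "f \<in> borel_measurable M" "g \<in> borel_measurable M"
  shows "(\<lambda>x. f x *v g x) \<in> borel_measurable M"
  unfolding matrix_vector_mult_def by measurable

lemma borel_measurable_transpose [measurable (raw)]:
  fixes f :: "'a \<Rightarrow> real^'n^'m"
  assumes [measurable]: "f \<in> borel_measurable M"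
  shows "(\<lambda>x. transpose (f x)) \<in> borel_measurable M"
  unfolding transpose_def by measurable

lemma borel_measurable_det [measurable (raw)]:
  fixes f :: "'a \<Rightarrow> real^'n^'n"
  assumes [measurable]: "f \<in> borel_measurable M"
  shows "(\<lambda>x. det (f x)) \<in> borel_measurable M"
  unfolding det_def by measurable

lemma borel_measurable_outer [measurable (raw)]:
  fixes f :: "'a \<Rightarrow> real^'n"
  assumes [measurable]: "f \<in> borel_measurable M"
  shows "(\<lambda>x. outer (f x)) \<in> borel_measurable M"
  unfolding outer_def by measurable

section \<open>Matrix inverses and their measurability\<close>

lemma matrix_inv_mult:
  fixes A :: "real^'n^'n"
  assumes "det A \<noteq> 0"
  shows "A ** matrix_inv A = mat 1" "matrix_inv A ** A = mat 1"
  using assms unfolding invertible_det_nz[symmetric] invertible_def matrix_inv_def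
  by (metis (mono_tags, lifting) someI_ex)+

lemma matrix_inv_unique:
  fixes A :: "real^'n^'n"
  assumes "A ** B = mat 1"
  shows "matrix_inv A = B"
proof -
  have "det A \<noteq> 0"
    using assms by (metis det_I det_mul mult_zero_left zero_neq_one)
  then show ?thesis
    by (metis assms matrix_inv_mult(2) matrix_mul_assoc matrix_mul_lid matrix_mul_rid)
qed

text \<open>Cramer's rule gives the entries as quotients of determinants where \<open>det A\<close>
  is nonzero. On singular matrices \<open>matrix_inv\<close> chooses from an empty predicate, so it
  takes a single constant value there.\<close>

lemma borel_measurable_matrix_inv [measurable (raw)]:
  fixes f :: "'a \<Rightarrow> real^'n^'n"
  assumes [measurable]: "f \<in> borel_measurable M"
  shows "(\<lambda>x. matrix_inv (f x)) \<in> borel_measurable M"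
proof -
  define C :: "real^'n^'n \<Rightarrow> real^'n^'n"
    where "C A = (\<chi> k l. det (\<chi> i j. if j = k then axis l 1 $ i else A $ i $ j) / det A)" for A
  have inv: "matrix_inv A = C A" if "det A \<noteq> 0" for A
  proof -
    have "matrix_inv A $ k $ l = C A $ k $ l" for k l
    proof -
      have "A *v (matrix_inv A *v axis l 1) = axis l 1"
        using that by (simp add: matrix_vector_mul_assoc matrix_inv_mult)
      then have "matrix_inv A *v axis l 1 =
          (\<chi> k. det (\<chi> i j. if j = k then axis l 1 $ i else A $ i $ j) / det A)"
        using cramer[OF that] by blast
      then show ?thesis
        by (simp add: C_def matrix_vector_mult_basis column_def vec_eq_iff)
    qed
    then show ?thesis by (simp add: vec_eq_iff)
  qed
  have sing: "matrix_inv A = (SOME B. False)" if "det A = 0" for A :: "real^'n^'n"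
  proof -
    have "\<not> (A ** B = mat 1 \<and> B ** A = mat 1)" for B
      using that invertible_det_nz[of A] unfolding invertible_def by blast
    then have "(\<lambda>B. A ** B = mat 1 \<and> B ** A = mat 1) = (\<lambda>B. False)" by blast
    then show ?thesis unfolding matrix_inv_def by simp
  qed
  have "matrix_inv A = (if det A = 0 then (SOME B. False) else C A)" for A
    using inv sing by auto
  moreover have "(\<lambda>x. if det (f x) = 0 then (SOME B. False) else C (f x)) \<in> borel_measurable M"
    unfolding C_def by measurable
  ultimately show ?thesis by simp
qed

subsection \<open>Positive definite matrices and their Cholesky factors\<close>

lemma inner_outer_mult: "x \<bullet> (outer v *v x) = (x \<bullet> v)\<^sup>2"
proof -
  have "x \<bullet> (outer v *v x) = (\<Sum>i\<in>UNIV. \<Sum>j\<in>UNIV. (x $ i * v $ i) * (x $ j * v $ j))"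
    by (simp add: inner_vec_def matrix_vector_mult_def outer_def sum_distrib_left algebra_simps)
  also have "\<dots> = (x \<bullet> v)\<^sup>2"
    by (simp add: inner_vec_def power2_eq_square sum_product)
  finally show ?thesis .
qed

lemma pos_def_mat_det_nz:
  assumes "pos_def_mat A"
  shows "det A \<noteq> 0"
proof -
  have "x = 0" if "A *v x = 0" for x
    using assms that unfolding pos_def_mat_def by (metis inner_zero_right less_irrefl)
  then show ?thesis
    unfolding invertible_det_nz[symmetric] invertible_left_inverse matrix_left_invertible_ker by blast
qed

text \<open>Semidefiniteness is a closed condition and the determinant is measurable, so this form
  yields measurability of \<open>pos_def_mat\<close>. For the converse: if the form vanishes at a
  nonzero \<open>x\<close>, then \<open>A x\<close> is nonzero, and moving \<open>x\<close> a
  suitable distance against \<open>A x\<close> makes the form negative.\<close>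

lemma pos_def_mat_iff_psd_det:
  "pos_def_mat A \<longleftrightarrow> transpose A = A \<and> (\<forall>x. x \<bullet> (A *v x) \<ge> 0) \<and> det A \<noteq> 0"
proof (intro iffI conjI allI)
  assume P: "pos_def_mat A"
  then show "transpose A = A" "det A \<noteq> 0" by (auto simp: pos_def_mat_def pos_def_mat_det_nz)
  fix x show "x \<bullet> (A *v x) \<ge> 0"
    using P by (cases "x = 0") (auto simp: pos_def_mat_def intro: less_imp_le)
next
  assume "transpose A = A \<and> (\<forall>x. x \<bullet> (A *v x) \<ge> 0) \<and> det A \<noteq> 0"
  then have sym: "transpose A = A" and psd: "\<And>x. x \<bullet> (A *v x) \<ge> 0" and det: "det A \<noteq> 0"
    by auto
  have "x \<bullet> (A *v x) > 0" if "x \<noteq> 0" for x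
  proof (rule ccontr)
    assume "\<not> x \<bullet> (A *v x) > 0"
    with psd[of x] have 0: "x \<bullet> (A *v x) = 0" by linarith
    define y where "y = A *v x"
    have "y \<noteq> 0"
      using that det unfolding y_def invertible_det_nz[symmetric] invertible_left_inverse
        matrix_left_invertible_ker by blast
    define a b where "a = y \<bullet> y" and "b = y \<bullet> (A *v y)"
    have a: "a > 0" and b: "b \<ge> 0" using \<open>y \<noteq> 0\<close> psd by (auto simp: a_def b_def)
    have xAy: "x \<bullet> (A *v y) = a"
      unfolding a_def y_def by (metis dot_lmul_matrix sym transpose_matrix_vector)
    \<comment> \<open>Along \<open>x + t y\<close> the form equals \<open>2 t a + t^2 b\<close>. The
      choice \<open>t = - a / (b + 1)\<close> makes it negative for every \<open>b \<ge> 0\<close>,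
      including \<open>b = 0\<close>, where there is no minimiser.\<close>
    define u where "u = 1 / (b + 1)"
    have u: "u > 0" "u * b = 1 - u" using b by (simp_all add: u_def field_simps)
    define t where "t = - a * u"
    have "(x + t *\<^sub>R y) \<bullet> (A *v (x + t *\<^sub>R y)) = 2 * t * a + t\<^sup>2 * b"
      using 0 xAy
      by (simp add: matrix_vector_right_distrib matrix_vector_mult_scaleR inner_add_left inner_add_right
          a_def[symmetric] b_def[symmetric] y_def[symmetric] power2_eq_square)
         (simp add: a_def algebra_simps)
    also have "\<dots> = a\<^sup>2 * (u * (u * b) - 2 * u)"
      by (simp add: t_def power2_eq_square algebra_simps)
    also have "\<dots> = - (a\<^sup>2 * (u + u\<^sup>2))"
      unfolding u(2) by (simp add: power2_eq_square algebra_simps)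
    also have "\<dots> < 0"
      using a u(1) by (simp add: add_pos_pos)
    finally show False using psd by (meson not_le)
  qed
  with sym show "pos_def_mat A" by (simp add: pos_def_mat_def)
qed

lemma pred_pos_def_mat [measurable (raw)]:
  fixes f :: "'a \<Rightarrow> real^'n^'n"
  assumes [measurable]: "f \<in> borel_measurable M"
  shows "Measurable.pred M (\<lambda>x. pos_def_mat (f x))"
proof -
  have c: "closed {A::real^'n^'n. \<forall>x. x \<bullet> (A *v x) \<ge> 0}"
    unfolding matrix_vector_mult_def
    by (intro closed_Collect_all closed_Collect_le continuous_intros)
  have [measurable]: "Measurable.pred borel (\<lambda>A::real^'n^'n. \<forall>x. x \<bullet> (A *v x) \<ge> 0)"
    using borel_closed[OF c] by (simp add: pred_def)
  show ?thesis
    unfolding pos_def_mat_iff_psd_det by measurable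
qed

lemma pos_def_mat_mult_transpose:
  fixes X :: "real^'n^'n"
  assumes "det X \<noteq> 0"
  shows "pos_def_mat (X ** transpose X)"
  unfolding pos_def_mat_iff_psd_det
proof (intro conjI allI)
  fix x
  have "x \<bullet> ((X ** transpose X) *v x) = (x v* X) \<bullet> (x v* X)"
    by (metis dot_lmul_matrix matrix_vector_mul_assoc transpose_matrix_vector)
  then show "x \<bullet> ((X ** transpose X) *v x) \<ge> 0" by simp
qed (use assms in \<open>auto simp: matrix_transpose_mul det_mul\<close>)

section \<open>Existence, uniqueness and measurability of Cholesky factors\<close>

lemma linorder_finite_induct [case_names less]:
  fixes j :: "'n::{finite,linorder}"
  assumes "\<And>j. (\<And>k. k < j \<Longrightarrow> P k) \<Longrightarrow> P j"
  shows "P j"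
proof (induction "card {..<j}" arbitrary: j rule: less_induct)
  case less
  have "card {..<k} < card {..<j}" if "k < j" for k
    using that by (intro psubset_card_mono) auto
  then show ?case using less assms by blast
qed

text \<open>Row \<open>j\<close> of \<open>L\<close> ends at the diagonal, so only
  \<open>k \<le> j\<close> contributes. Splitting off \<open>k = j\<close> gives the recursion that
  determines column \<open>j\<close> from the earlier ones; uniqueness and measurability of the
  factor both rest on it.\<close>

lemma lower_tri_mult_transpose:
  assumes "lower_tri L"
  shows "(L ** transpose L) $ i $ j = (\<Sum>k<j. L $ i $ k * L $ j $ k) + L $ i $ j * L $ j $ j"
proof -
  have "(L ** transpose L) $ i $ j = (\<Sum>k\<in>UNIV. L $ i $ k * L $ j $ k)"
    by (simp add: matrix_matrix_mult_def transpose_def)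
  also have "\<dots> = (\<Sum>k\<in>insert j {..<j}. L $ i $ k * L $ j $ k)"
    using assms by (intro sum.mono_neutral_right) (auto simp: lower_tri_def not_less)
  also have "\<dots> = (\<Sum>k<j. L $ i $ k * L $ j $ k) + L $ i $ j * L $ j $ j"
    by simp
  finally show ?thesis .
qed

text \<open>Columns are recovered in increasing order: the recursion at \<open>i = j\<close> gives
  the square of the diagonal entry, positivity fixes its sign, and division by it gives the rest of
  the column.\<close>

lemma lower_tri_mult_transpose_inject:
  assumes L: "lower_tri L" "\<And>i. L $ i $ i > 0" and M: "lower_tri M" "\<And>i. M $ i $ i > 0"
    and eq: "L ** transpose L = M ** transpose M"
  shows "L = M"
proof -
  have "\<forall>i. L $ i $ j = M $ i $ j" for j
  proof (induction j rule: linorder_finite_induct)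
    case (less j)
    have *: "L $ i $ j * L $ j $ j = M $ i $ j * M $ j $ j" for i
      using arg_cong[OF eq, of "\<lambda>A. A $ i $ j"] less
      by (simp add: lower_tri_mult_transpose L(1) M(1))
    have "L $ j $ j = M $ j $ j"
      using *[of j] L(2)[of j] M(2)[of j] by (metis less_imp_le power2_eq_iff_nonneg power2_eq_square)
    then show ?case using * L(2)[of j] by (metis less_irrefl mult_right_cancel)
  qed
  then show ?thesis by (simp add: vec_eq_iff)
qed

text \<open>One step of the elimination: the part of \<open>A\<close> still to be factored, supported outside the
  initial segment \<open>K\<close>, is replaced by its Schur complement with respect to the least index
  not in \<open>K\<close>.\<close>
lemma partial_cholesky_exists:
  fixes A :: "real^'n::{finite,linorder}^'n::{finite,linorder}"
  assumes A: "pos_def_mat A"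
  shows "n \<le> CARD('n) \<Longrightarrow> \<exists>K l R. card K = n \<and> (\<forall>k\<in>K. \<forall>j. j \<notin> K \<longrightarrow> k < j) \<and>
     A = (\<Sum>k\<in>K. outer (l k)) + R \<and> (\<forall>k\<in>K. \<forall>i<k. l k $ i = 0) \<and> (\<forall>k\<in>K. l k $ k > 0) \<and>
     (\<forall>i\<in>K. \<forall>j. R $ i $ j = 0) \<and> transpose R = R \<and>
     (\<forall>x. x \<noteq> 0 \<longrightarrow> (\<forall>i\<in>K. x $ i = 0) \<longrightarrow> x \<bullet> (R *v x) > 0)"
    (is "_ \<Longrightarrow> \<exists>K l R. ?I n K l R")
proof (induction n)
  case 0
  show ?case using A by (intro exI[of _ "{}"] exI[of _ A]) (auto simp: pos_def_mat_def)
next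
  case (Suc n)
  obtain K :: "'n set" and l R where H: "?I n K l R"
    using Suc.IH[OF Suc_leD[OF Suc.prems]] by (elim exE) (rule that)
  have K: "card K = n" "\<And>k j. k \<in> K \<Longrightarrow> j \<notin> K \<Longrightarrow> k < j"
    and AR: "A = (\<Sum>k\<in>K. outer (l k)) + R" and l: "\<And>k i. k \<in> K \<Longrightarrow> i < k \<Longrightarrow> l k $ i = 0"
      "\<And>k. k \<in> K \<Longrightarrow> l k $ k > 0"
    and R0: "\<And>i j. i \<in> K \<Longrightarrow> R $ i $ j = 0" and sym: "transpose R = R"
    and pd: "\<And>x. x \<noteq> 0 \<Longrightarrow> (\<And>i. i \<in> K \<Longrightarrow> x $ i = 0) \<Longrightarrow> x \<bullet> (R *v x) > 0"
    using H by blast+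
  have "K \<noteq> UNIV" using K(1) Suc.prems by auto
  then have "- K \<noteq> {}" by auto
  define m where "m = Min (- K)"
  have m: "m \<notin> K" "\<And>j. j \<notin> K \<Longrightarrow> m \<le> j"
    using Min_in[of "- K"] Min_le[of "- K"] \<open>- K \<noteq> {}\<close> by (auto simp: m_def)
  have symc: "R $ i $ j = R $ j $ i" for i j
    using sym by (metis transpose_def vec_lambda_beta)
  define r where "r = R $ m $ m"
  have Raxis: "(R *v axis m 1) $ i = R $ i $ m" for i
    by (simp add: matrix_vector_mult_basis column_def)
  have "axis m 1 \<bullet> (R *v axis m 1) > 0"
    using m(1) by (intro pd) (auto simp: axis_def vec_eq_iff)
  then have r: "r > 0"
    using Raxis[of m] by (simp add: inner_axis' r_def)
  \<comment> \<open>The next column of the factor: \<open>outer v\<close> agrees with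
    \<open>R\<close> in row and column \<open>m\<close>, so subtracting it clears both.\<close>
  define v where "v = (\<chi> i. R $ i $ m / sqrt r)"
  define R' where "R' = R - outer v"
  have vmul: "v $ i * v $ j = R $ i $ m * R $ j $ m / r" for i j
    using r by (simp add: v_def)
  have R'0: "R' $ i $ j = 0" if "i \<in> insert m K" for i j
    using that r R0 symc[of m j] vmul[of i j] by (auto simp: R'_def outer_def r_def)
  have pd': "x \<bullet> (R' *v x) > 0" if x: "x \<noteq> 0" "\<And>i. i \<in> insert m K \<Longrightarrow> x $ i = 0" for x
  proof -
    define b where "b = (R *v x) $ m"
    have xRm: "x \<bullet> (R *v axis m 1) = b"
      unfolding b_def using sym
      by (metis cart_eq_inner_axis dot_lmul_matrix inner_commute transpose_matrix_vector)
    \<comment> \<open>\<open>y\<close> minimises the form of \<open>R\<close> on the line through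
      \<open>x\<close> in direction \<open>axis m 1\<close>, and the minimum is the value of the
      Schur complement at \<open>x\<close>. Since \<open>x $ m = 0\<close>, \<open>y\<close> cannot
      be zero.\<close>
    define y where "y = x - (b / r) *\<^sub>R axis m 1"
    have "y \<noteq> 0"
    proof
      assume "y = 0"
      then have "x $ i = 0" for i
        using x(2)[of i] by (cases "i = m") (auto simp: y_def axis_def vec_eq_iff)
      with x(1) show False by (simp add: vec_eq_iff)
    qed
    moreover have "y $ i = 0" if "i \<in> K" for i
      using that m(1) x(2) by (auto simp: y_def axis_def)
    ultimately have "0 < y \<bullet> (R *v y)" by (rule pd)
    also have "y \<bullet> (R *v y) = x \<bullet> (R *v x) - 2 * (b / r) * b + (b / r)\<^sup>2 * r"
      using xRm Raxis[of m]
      by (simp add: y_def matrix_vector_mult_diff_distrib matrix_vector_mult_scaleR inner_diff_left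
          inner_diff_right inner_axis' b_def[symmetric] r_def[symmetric] power2_eq_square)
    also have "\<dots> = x \<bullet> (R *v x) - b\<^sup>2 / r"
      using r by (simp add: field_simps power2_eq_square)
    also have "b\<^sup>2 / r = (x \<bullet> v)\<^sup>2"
    proof -
      have "v = (1 / sqrt r) *\<^sub>R (R *v axis m 1)"
        by (simp add: vec_eq_iff v_def Raxis)
      then have "x \<bullet> v = b / sqrt r" using xRm by simp
      then show ?thesis using r by (simp add: power_divide)
    qed
    also have "x \<bullet> (R *v x) - (x \<bullet> v)\<^sup>2 = x \<bullet> (R' *v x)"
      by (simp add: R'_def matrix_vector_mult_diff_rdistrib inner_diff_right inner_outer_mult)
    finally show ?thesis .
  qed
  have vlt: "v $ i = 0" if "i < m" for i
  proof -
    have "i \<in> K" using that m(2)[of i] by (meson not_le)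
    then show ?thesis by (simp add: v_def R0)
  qed
  have vm: "v $ m > 0" using r by (simp add: v_def r_def[symmetric])
  let ?l = "l(m := v)"
  have "A = (\<Sum>k\<in>insert m K. outer (?l k)) + R'"
  proof -
    have "(\<Sum>k\<in>K. outer (?l k)) = (\<Sum>k\<in>K. outer (l k))"
      using m(1) by (intro sum.cong) auto
    then show ?thesis using m(1) AR by (simp add: R'_def)
  qed
  moreover have "transpose R' = R'"
    using symc by (simp add: R'_def transpose_def vec_eq_iff outer_def mult.commute)
  moreover have "k < j" if "k \<in> insert m K" "j \<notin> insert m K" for k j
    using that K(2) m(2)[of j] by (auto simp: order.order_iff_strict)
  moreover have "card (insert m K) = Suc n" using m(1) K(1) by simp
  moreover have "\<forall>k\<in>insert m K. \<forall>i<k. ?l k $ i = 0" "\<forall>k\<in>insert m K. ?l k $ k > 0"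
    using vlt vm l m(1) by auto
  ultimately have "?I (Suc n) (insert m K) ?l R'"
    using R'0 pd' by blast
  then show ?case by blast
qed

lemma cholesky_exists:
  fixes A :: "real^'n::{finite,linorder}^'n::{finite,linorder}"
  assumes A: "pos_def_mat A"
  shows "\<exists>L. lower_tri L \<and> (\<forall>i. L $ i $ i > 0) \<and> L ** transpose L = A"
proof -
  obtain K :: "'n set" and l R where K: "card K = CARD('n)"
    and AR: "A = (\<Sum>k\<in>K. outer (l k)) + R" and l: "\<forall>k\<in>K. \<forall>i<k. l k $ i = 0"
      "\<forall>k\<in>K. l k $ k > 0" and R0: "\<forall>i\<in>K. \<forall>j. R $ i $ j = 0"
    using partial_cholesky_exists[OF A order_refl] by (elim exE conjE) (rule that)
  have [simp]: "K = UNIV" using K by (metis card_eq_UNIV_imp_eq_UNIV finite)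
  have "R = 0" using R0 by (simp add: vec_eq_iff)
  have "(\<chi> i k. l k $ i) ** transpose (\<chi> i k. l k $ i) = A"
    by (simp add: AR \<open>R = 0\<close> vec_eq_iff matrix_matrix_mult_def transpose_def outer_def)
  with l show ?thesis
    by (intro exI[of _ "\<chi> i k. l k $ i"]) (auto simp: lower_tri_def)
qed

lemma chol_props:
  assumes "pos_def_mat A"
  shows lower_tri_chol: "lower_tri (chol A)"
    and chol_diag_pos: "chol A $ i $ i > 0"
    and chol_mult_transpose: "chol A ** transpose (chol A) = A"
proof -
  have "\<exists>!L. lower_tri L \<and> (\<forall>i. L $ i $ i > 0) \<and> L ** transpose L = A"
    using cholesky_exists[OF assms] lower_tri_mult_transpose_inject by metis
  from theI'[OF this] assms show "lower_tri (chol A)" "chol A $ i $ i > 0"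
    "chol A ** transpose (chol A) = A"
    by (auto simp: chol_def)
qed

lemma det_chol_squared:
  assumes "pos_def_mat A"
  shows "(det (chol A))\<^sup>2 = det A"
  by (metis assms chol_mult_transpose det_mul det_transpose power2_eq_square)

lemma pos_def_mat_det_pos:
  fixes A :: "real^'n::{finite,linorder}^'n::{finite,linorder}"
  assumes "pos_def_mat A"
  shows "det A > 0"
  using det_chol_squared[OF assms] pos_def_mat_det_nz[OF assms]
  by (metis zero_less_power2 zero_eq_power2)

lemma det_chol_nz: "pos_def_mat A \<Longrightarrow> det (chol A) \<noteq> 0"
  using det_chol_squared[of A] pos_def_mat_det_nz[of A] by auto

lemma chol_inv_mult:
  assumes "pos_def_mat A"
  shows "chol A ** chol_inv A = mat 1" "chol_inv A ** chol A = mat 1"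
  using assms det_chol_nz[OF assms] by (simp_all add: chol_inv_def matrix_inv_mult)

text \<open>Induction over the columns: on positive definite matrices the recursion writes column
  \<open>j\<close> with a square root and quotients of measurable functions of the earlier columns,
  and elsewhere \<open>chol\<close> is 0. The diagonal entry comes first because the other entries
  are divided by it.\<close>

lemma borel_measurable_chol [measurable (raw)]:
  fixes f :: "'a \<Rightarrow> real^'n::{finite,linorder}^'n::{finite,linorder}"
  assumes [measurable]: "f \<in> borel_measurable M"
  shows "(\<lambda>x. chol (f x)) \<in> borel_measurable M"
proof -
  have "\<forall>i. (\<lambda>x. chol (f x) $ i $ j) \<in> borel_measurable M" for j
  proof (induction j rule: linorder_finite_induct)
    case (less j)
    then have IH [measurable]: "(\<lambda>x. chol (f x) $ i $ k) \<in> borel_measurable M" if "k \<in> {..<j}" for i k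
      using that by simp
    have rec: "A $ i $ j = (\<Sum>k<j. chol A $ i $ k * chol A $ j $ k) + chol A $ i $ j * chol A $ j $ j"
      if "pos_def_mat A" for A and i
      using lower_tri_mult_transpose[OF lower_tri_chol[OF that], of i j]
      by (simp add: chol_mult_transpose that)
    have "(\<lambda>x. chol (f x) $ j $ j) = (\<lambda>x. if pos_def_mat (f x) then
        sqrt (f x $ j $ j - (\<Sum>k<j. chol (f x) $ j $ k * chol (f x) $ j $ k)) else 0)"
      using rec[of _ j] chol_diag_pos[of _ j] by (intro ext) (auto simp: chol_def less_imp_le)
    then have diag [measurable]: "(\<lambda>x. chol (f x) $ j $ j) \<in> borel_measurable M"
      by (rule ssubst) measurable
    have "(\<lambda>x. chol (f x) $ i $ j) = (\<lambda>x. if pos_def_mat (f x) then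
        (f x $ i $ j - (\<Sum>k<j. chol (f x) $ i $ k * chol (f x) $ j $ k)) / chol (f x) $ j $ j else 0)" for i
    proof
      fix x
      show "chol (f x) $ i $ j = (if pos_def_mat (f x) then
        (f x $ i $ j - (\<Sum>k<j. chol (f x) $ i $ k * chol (f x) $ j $ k)) / chol (f x) $ j $ j else 0)"
        using rec[of "f x" i] chol_diag_pos[of "f x" j]
        by (cases "pos_def_mat (f x)") (simp_all add: field_simps, simp add: chol_def)
    qed
    then have "(\<lambda>x. chol (f x) $ i $ j) \<in> borel_measurable M" for i
      by (rule ssubst) measurable
    then show ?case by simp
  qed
  then have "(\<lambda>x. \<chi> i j. chol (f x) $ i $ j) \<in> borel_measurable M"
    by (intro borel_measurable_vec_lambda) blast
  then show ?thesis by simp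
qed

lemma borel_measurable_chol_inv [measurable (raw)]:
  fixes f :: "'a \<Rightarrow> real^'n::{finite,linorder}^'n::{finite,linorder}"
  assumes [measurable]: "f \<in> borel_measurable M"
  shows "(\<lambda>x. chol_inv (f x)) \<in> borel_measurable M"
  unfolding chol_inv_def by measurable

subsection \<open>Lebesgue measure on vectors and matrices\<close>

lemma prod_Basis_vec:
  "(\<Prod>b\<in>(Basis :: ('b::euclidean_space^'n) set). f b) = (\<Prod>i\<in>UNIV. \<Prod>b\<in>Basis. f (axis i b))"
proof -
  have *: "(Basis :: ('b^'n) set) = (\<Union>i\<in>UNIV. axis i ` Basis)"
    by (auto simp: Basis_vec_def)
  have "(\<Prod>b\<in>(Basis :: ('b^'n) set). f b) = (\<Prod>i\<in>UNIV. \<Prod>b\<in>axis i ` Basis. f b)"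
    unfolding * by (subst prod.UNION_disjoint) (auto simp: axis_eq_axis)
  also have "\<dots> = (\<Prod>i\<in>UNIV. \<Prod>b\<in>Basis. f (axis i b))"
    by (intro prod.cong refl, subst prod.reindex) (auto simp: inj_on_def axis_eq_axis)
  finally show ?thesis .
qed

lemma mem_box_vec:
  fixes x :: "'b::euclidean_space^'n"
  shows "x \<in> box l u \<longleftrightarrow> (\<forall>i. x $ i \<in> box (l $ i) (u $ i))"
  by (auto simp: mem_box Basis_vec_def inner_axis)

lemma product_sigma_finite_lborel: "product_sigma_finite (\<lambda>_. lborel :: 'a::euclidean_space measure)"
  by (simp add: product_sigma_finite_def lborel.sigma_finite_measure_axioms)

interpretation lborel_product: product_sigma_finite "\<lambda>_. lborel :: 'a::euclidean_space measure"
  by (rule product_sigma_finite_lborel)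

lemma measurable_vec_lambda_PiM [measurable]:
  "vec_lambda \<in> borel_measurable (PiM UNIV (\<lambda>_::'n::finite. lborel :: 'b::euclidean_space measure))"
  by measurable

text \<open>A box is the product of boxes in the components, and Lebesgue measure is determined by
  its values on boxes. Since \<open>'b\<close> may itself be a vector type, matrices are covered as
  families of rows.\<close>

lemma lborel_vec_eq_distr_PiM:
  "(lborel :: ('b::euclidean_space^'n) measure) = distr (PiM UNIV (\<lambda>_. lborel)) borel vec_lambda"
proof (rule lborel_eqI)
  fix l u :: "'b^'n"
  assume le: "\<And>b. b \<in> Basis \<Longrightarrow> l \<bullet> b \<le> u \<bullet> b"
  have le': "l $ i \<bullet> b \<le> u $ i \<bullet> b" if "b \<in> Basis" for i b
    using le[of "axis i b"] that by (simp add: inner_axis)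
  have "vec_lambda -` box l u \<inter> space (PiM UNIV (\<lambda>_. lborel)) = Pi\<^sub>E UNIV (\<lambda>i. box (l $ i) (u $ i))"
    by (auto simp: mem_box_vec space_PiM PiE_iff)
  then have "emeasure (distr (PiM UNIV (\<lambda>_. lborel)) borel vec_lambda) (box l u)
      = (\<Prod>i\<in>UNIV. emeasure lborel (box (l $ i) (u $ i)))"
    by (simp add: emeasure_distr lborel_product.emeasure_PiM)
  also have "\<dots> = (\<Prod>i\<in>UNIV. ennreal (\<Prod>b\<in>Basis. (u $ i - l $ i) \<bullet> b))"
    by (intro prod.cong refl emeasure_lborel_box le')
  also have "\<dots> = ennreal (\<Prod>b\<in>Basis. (u - l) \<bullet> b)"
    by (subst prod_ennreal) (auto intro!: prod_nonneg simp: inner_diff_left le' prod_Basis_vec inner_axis)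
  finally show "emeasure (distr (PiM UNIV (\<lambda>_. lborel)) borel vec_lambda) (box l u)
      = ennreal (\<Prod>b\<in>Basis. (u - l) \<bullet> b)" .
qed simp

lemma nn_integral_lborel_vec:
  fixes f :: "'b::euclidean_space^'n \<Rightarrow> ennreal"
  assumes [measurable]: "f \<in> borel_measurable borel"
  shows "(\<integral>\<^sup>+x. f x \<partial>lborel) = (\<integral>\<^sup>+x. f (vec_lambda x) \<partial>PiM UNIV (\<lambda>_. lborel))"
  by (subst lborel_vec_eq_distr_PiM) (simp add: nn_integral_distr)

lemma nn_integral_lborel_transpose:
  fixes f :: "real^'n^'m \<Rightarrow> ennreal"
  assumes [measurable]: "f \<in> borel_measurable borel"
  shows "(\<integral>\<^sup>+X. f (transpose X) \<partial>lborel) = (\<integral>\<^sup>+X. f X \<partial>lborel)"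
proof -
  have "lborel = distr lborel borel (transpose :: real^'m^'n \<Rightarrow> real^'n^'m)"
  proof (rule lborel_eqI)
    fix l u :: "real^'n^'m"
    assume le: "\<And>b. b \<in> Basis \<Longrightarrow> l \<bullet> b \<le> u \<bullet> b"
    have le': "l $ i $ j \<le> u $ i $ j" for i j
      using le[of "axis i (axis j 1)"] by (simp add: inner_axis)
    have "transpose -` box l u = box (transpose l) (transpose u)"
      by (auto simp: mem_box_vec transpose_def)
    then have "emeasure (distr lborel borel transpose) (box l u)
        = emeasure lborel (box (transpose l) (transpose u))"
      by (simp add: emeasure_distr)
    also have "\<dots> = ennreal (\<Prod>b\<in>Basis. (transpose u - transpose l) \<bullet> b)"
      by (intro emeasure_lborel_box) (auto simp: Basis_vec_def inner_axis transpose_def le')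
    also have "(\<Prod>b\<in>Basis. (transpose u - transpose l) \<bullet> b) = (\<Prod>b\<in>Basis. (u - l) \<bullet> b)"
      by (simp add: prod_Basis_vec inner_axis transpose_def prod.swap[of _ "UNIV::'n set"])
    finally show "emeasure (distr lborel borel transpose) (box l u) = ennreal (\<Prod>b\<in>Basis. (u - l) \<bullet> b)" .
  qed simp
  then have "(\<integral>\<^sup>+X. f X \<partial>lborel) = (\<integral>\<^sup>+X. f X \<partial>distr lborel borel (transpose :: real^'m^'n \<Rightarrow> real^'n^'m))"
    by simp
  then show ?thesis by (simp add: nn_integral_distr)
qed

section \<open>Linear substitutions in Lebesgue integrals\<close>

text \<open>The corresponding results on linear images in the library assume a well-ordered index type.\<close>
lemma nn_integral_lborel_linear:
  fixes g :: "real^'n \<Rightarrow> real^'n"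
  assumes "linear g" "det (matrix g) \<noteq> 0" "f \<in> borel_measurable borel"
  shows "ennreal \<bar>det (matrix g)\<bar> * (\<integral>\<^sup>+x. f (g x) \<partial>lborel) = (\<integral>\<^sup>+x. f x \<partial>lborel)"
proof -
  have lin_meas: "h \<in> borel_measurable borel" if "linear h" for h :: "real^'n \<Rightarrow> real^'n"
    using that by (intro borel_measurable_continuous_onI linear_continuous_on)
      (simp add: linear_conv_bounded_linear)
  let ?P = "\<lambda>g :: real^'n \<Rightarrow> real^'n. det (matrix g) \<noteq> 0 \<longrightarrow> (\<forall>f\<in>borel_measurable borel.
     ennreal \<bar>det (matrix g)\<bar> * (\<integral>\<^sup>+x. f (g x) \<partial>lborel) = (\<integral>\<^sup>+x. f x \<partial>lborel))"
  have "?P g"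
  proof (rule induct_linear_elementary[OF \<open>linear g\<close>])
    fix g h :: "real^'n \<Rightarrow> real^'n"
    assume lin: "linear g" "linear h" and P: "?P g" "?P h"
    show "?P (g \<circ> h)"
    proof (intro impI ballI)
      assume "det (matrix (g \<circ> h)) \<noteq> 0"
      then have nz: "det (matrix g) \<noteq> 0" "det (matrix h) \<noteq> 0"
        by (auto simp: matrix_compose[OF lin(2,1)] det_mul)
      fix f :: "real^'n \<Rightarrow> ennreal" assume [measurable]: "f \<in> borel_measurable borel"
      note [measurable] = lin_meas[OF lin(1)] lin_meas[OF lin(2)]
      have "ennreal \<bar>det (matrix (g \<circ> h))\<bar> * (\<integral>\<^sup>+x. f ((g \<circ> h) x) \<partial>lborel)
          = ennreal \<bar>det (matrix g)\<bar> * (ennreal \<bar>det (matrix h)\<bar> * (\<integral>\<^sup>+x. f (g (h x)) \<partial>lborel))"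
        by (simp add: matrix_compose[OF lin(2,1)] det_mul abs_mult ennreal_mult mult.assoc)
      also have "ennreal \<bar>det (matrix h)\<bar> * (\<integral>\<^sup>+x. f (g (h x)) \<partial>lborel) = (\<integral>\<^sup>+x. f (g x) \<partial>lborel)"
        using P(2) nz(2) by (auto dest!: bspec[where x = "\<lambda>x. f (g x)"])
      also have "ennreal \<bar>det (matrix g)\<bar> * (\<integral>\<^sup>+x. f (g x) \<partial>lborel) = (\<integral>\<^sup>+x. f x \<partial>lborel)"
        using P(1) nz(1) by auto
      finally show "ennreal \<bar>det (matrix (g \<circ> h))\<bar> * (\<integral>\<^sup>+x. f ((g \<circ> h) x) \<partial>lborel) = (\<integral>\<^sup>+x. f x \<partial>lborel)" .
    qed
  next
    fix g :: "real^'n \<Rightarrow> real^'n" and i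
    assume "linear g" and 0: "\<And>x. g x $ i = 0"
    then have "\<not> inj g"
      by (metis (full_types) linear_injective_imp_surjective one_neq_zero surjE vec_component)
    then show "?P g" using det_nz_iff_inj[OF \<open>linear g\<close>] by blast
  next
    fix c :: "'n \<Rightarrow> real"
    let ?h = "\<lambda>x::real^'n. \<chi> i. c i * x $ i"
    have det: "det (matrix ?h) = (\<Prod>i\<in>UNIV. c i)"
      by (simp add: axis_def matrix_def det_diagonal)
    \<comment> \<open>\<open>c'\<close> carries the scale factors from the indices over to the basis
      vectors, the form in which \<open>lborel_affine_euclidean\<close> takes them.\<close>
    define c' :: "real^'n \<Rightarrow> real" where "c' b = b \<bullet> ?h b" for b
    have c'_axis: "c' (axis i 1) = c i" for i
      by (simp add: c'_def inner_axis')
    show "?P ?h"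
    proof (intro impI ballI)
      assume "det (matrix ?h) \<noteq> 0"
      then have nz: "c i \<noteq> 0" for i by (simp add: det)
      have nz': "c' j \<noteq> 0" if "j \<in> Basis" for j
        using that by (auto simp: Basis_vec_def c'_axis nz)
      have h: "0 + (\<Sum>j\<in>Basis. (c' j * (x \<bullet> j)) *\<^sub>R j) = ?h x" for x
      proof (rule euclidean_eqI)
        fix b :: "real^'n" assume b: "b \<in> Basis"
        then have "(0 + (\<Sum>j\<in>Basis. (c' j * (x \<bullet> j)) *\<^sub>R j)) \<bullet> b = c' b * (x \<bullet> b)"
          by (simp add: inner_sum_left inner_Basis if_distrib cong: if_cong)
        also have "\<dots> = ?h x \<bullet> b"
          using b by (auto simp: Basis_vec_def c'_axis inner_axis)
        finally show "(0 + (\<Sum>j\<in>Basis. (c' j * (x \<bullet> j)) *\<^sub>R j)) \<bullet> b = ?h x \<bullet> b" .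
      qed
      fix f :: "real^'n \<Rightarrow> ennreal" assume [measurable]: "f \<in> borel_measurable borel"
      have prod: "(\<Prod>j\<in>Basis. \<bar>c' j\<bar>) = \<bar>det (matrix ?h)\<bar>"
        by (simp add: prod_Basis_vec c'_axis det abs_prod)
      have "lborel = density (distr lborel borel ?h) (\<lambda>_. ennreal \<bar>det (matrix ?h)\<bar>)"
        using lborel_affine_euclidean[of c' 0] nz' unfolding h prod by blast
      then have "(\<integral>\<^sup>+x. f x \<partial>lborel) =
          (\<integral>\<^sup>+x. f x \<partial>density (distr lborel borel ?h) (\<lambda>_. ennreal \<bar>det (matrix ?h)\<bar>))"
        by simp
      also have "\<dots> = ennreal \<bar>det (matrix ?h)\<bar> * (\<integral>\<^sup>+x. f (?h x) \<partial>lborel)"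
        by (simp add: nn_integral_density nn_integral_distr nn_integral_cmult)
      finally show "ennreal \<bar>det (matrix ?h)\<bar> * (\<integral>\<^sup>+x. f (?h x) \<partial>lborel) = (\<integral>\<^sup>+x. f x \<partial>lborel)"
        by simp
    qed
  next
    fix m n :: 'n assume "m \<noteq> n"
    let ?t = "Transposition.transpose m n"
    let ?h = "\<lambda>v::real^'n. \<chi> i. v $ ?t i"
    have "matrix ?h = transpose (\<chi> i j. mat 1 $ i $ ?t j)"
      by (auto simp: vec_eq_iff transpose_def axis_def mat_def matrix_def)
    then have 1: "\<bar>det (matrix ?h)\<bar> = 1"
      by (simp add: det_permute_columns permutes_swap_id sign_swap_id abs_mult)
    have "lborel = distr lborel borel ?h"
    proof (rule lborel_eqI)
      fix l u :: "real^'n"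
      assume le: "\<And>b. b \<in> Basis \<Longrightarrow> l \<bullet> b \<le> u \<bullet> b"
      have le': "l $ i \<le> u $ i" for i
        using le[of "axis i 1"] by (simp add: inner_axis)
      have "?h -` box l u = box (?h l) (?h u)"
        by (auto simp: mem_box_vec) (metis transpose_involutory)+
      then have "emeasure (distr lborel borel ?h) (box l u) = emeasure lborel (box (?h l) (?h u))"
        by (simp add: emeasure_distr)
      also have "\<dots> = ennreal (\<Prod>b\<in>Basis. (?h u - ?h l) \<bullet> b)"
        by (intro emeasure_lborel_box) (auto simp: Basis_vec_def inner_axis le')
      also have "(\<Prod>b\<in>Basis. (?h u - ?h l) \<bullet> b) = (\<Prod>b\<in>Basis. (u - l) \<bullet> b)"
        using prod.permute[OF permutes_swap_id[of m UNIV n], where g="\<lambda>i. (u - l) $ i"]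
        by (simp add: prod_Basis_vec inner_axis o_def)
      finally show "emeasure (distr lborel borel ?h) (box l u) = ennreal (\<Prod>b\<in>Basis. (u - l) \<bullet> b)" .
    qed simp
    then have "(\<integral>\<^sup>+x. f (?h x) \<partial>lborel) = (\<integral>\<^sup>+x. f x \<partial>lborel)" if [measurable]: "f \<in> borel_measurable borel" for f
      using nn_integral_distr[of ?h lborel borel f] by simp
    with 1 show "?P ?h" by simp
  next
    fix m n :: 'n assume "m \<noteq> n"
    let ?h = "\<lambda>v::real^'n. \<chi> i. if i = m then v $ m + v $ n else v $ i"
    have "matrix ?h = (\<chi> k. if k = m then row m (mat 1) + 1 *s row n (mat 1) else row k (mat 1))"
      using \<open>m \<noteq> n\<close> by (auto simp: vec_eq_iff matrix_def axis_def row_def mat_def)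
    then have 1: "det (matrix ?h) = 1"
      using det_row_operation[OF \<open>m \<noteq> n\<close>, of "mat 1" 1] by simp
    have "(\<integral>\<^sup>+x. f (?h x) \<partial>lborel) = (\<integral>\<^sup>+x. f x \<partial>lborel)" if [measurable]: "f \<in> borel_measurable borel" for f
    proof -
      \<comment> \<open>Fubini splits off coordinate \<open>m\<close>. With the others fixed, the
        shear translates that coordinate by \<open>x n\<close>, which preserves Lebesgue measure on
        the line.\<close>
      let ?I = "UNIV - {m}"
      have U: "insert m ?I = UNIV" by auto
      have split: "(\<integral>\<^sup>+x. g x \<partial>lborel) = (\<integral>\<^sup>+x. \<integral>\<^sup>+y. g (vec_lambda (x(m := y))) \<partial>lborel \<partial>PiM ?I (\<lambda>_. lborel))"
        if [measurable]: "g \<in> borel_measurable borel" for g :: "real^'n \<Rightarrow> ennreal"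
        unfolding nn_integral_lborel_vec[OF that]
        using lborel_product.product_nn_integral_insert[of ?I m "\<lambda>x. g (vec_lambda x)"]
        unfolding U by simp
      have "(\<integral>\<^sup>+x. f (?h x) \<partial>lborel)
          = (\<integral>\<^sup>+x. \<integral>\<^sup>+y. f (?h (vec_lambda (x(m := y)))) \<partial>lborel \<partial>PiM ?I (\<lambda>_. lborel))"
        by (rule split) measurable
      also have "\<dots> = (\<integral>\<^sup>+x. \<integral>\<^sup>+y. f (vec_lambda (x(m := y))) \<partial>lborel \<partial>PiM ?I (\<lambda>_. lborel))"
      proof (rule nn_integral_cong)
        fix x :: "'n \<Rightarrow> real"
        have h: "?h (vec_lambda (x(m := y))) = vec_lambda (x(m := x n + 1 * y))" for y
          using \<open>m \<noteq> n\<close> by (auto simp: vec_eq_iff)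
        have [measurable]: "(\<lambda>y. vec_lambda (x(m := y))) \<in> borel_measurable borel"
          unfolding fun_upd_def by measurable
        have "(\<integral>\<^sup>+y. f (vec_lambda (x(m := y))) \<partial>lborel)
            = ennreal \<bar>1\<bar> * (\<integral>\<^sup>+y. f (vec_lambda (x(m := x n + 1 * y))) \<partial>lborel)"
          by (rule nn_integral_real_affine) auto
        then show "(\<integral>\<^sup>+y. f (?h (vec_lambda (x(m := y)))) \<partial>lborel) = (\<integral>\<^sup>+y. f (vec_lambda (x(m := y))) \<partial>lborel)"
          unfolding h by simp
      qed
      also have "\<dots> = (\<integral>\<^sup>+x. f x \<partial>lborel)"
        by (rule split[symmetric]) measurable
      finally show ?thesis .
    qed
    with 1 show "?P ?h" by simp
  qed
  with assms show ?thesis by blast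
qed

lemma nn_integral_lborel_matrix_vector:
  fixes A :: "real^'n^'n"
  assumes "det A \<noteq> 0" "f \<in> borel_measurable borel"
  shows "ennreal \<bar>det A\<bar> * (\<integral>\<^sup>+x. f (A *v x) \<partial>lborel) = (\<integral>\<^sup>+x. f x \<partial>lborel)"
  using nn_integral_lborel_linear[of "(*v) A" f] assms by simp

text \<open>Each member of the family contributes one factor \<bar>det A\<bar>; it is enough to
  compare the measures on products of Borel sets.\<close>

lemma nn_integral_PiM_lborel_matrix_vector:
  fixes A :: "real^'n^'n"
  assumes "finite I" and A: "det A \<noteq> 0" and [measurable]: "f \<in> borel_measurable (PiM I (\<lambda>_. lborel))"
  shows "ennreal (\<bar>det A\<bar> ^ card I) * (\<integral>\<^sup>+x. f (\<lambda>i\<in>I. A *v x i) \<partial>PiM I (\<lambda>_. lborel))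
     = (\<integral>\<^sup>+x. f x \<partial>PiM I (\<lambda>_. lborel))"
proof -
  let ?M = "PiM I (\<lambda>_. lborel :: (real^'n) measure)"
  let ?T = "\<lambda>x. \<lambda>i\<in>I. A *v x i"
  have T [measurable]: "?T \<in> ?M \<rightarrow>\<^sub>M ?M" by measurable
  have "density (distr ?M ?M ?T) (\<lambda>_. ennreal (\<bar>det A\<bar> ^ card I)) = ?M"
  proof (rule lborel_product.PiM_eqI)
    fix B :: "_ \<Rightarrow> (real^'n) set" assume B: "\<And>i. i \<in> I \<Longrightarrow> B i \<in> sets lborel"
    have B' [measurable]: "(*v) A -` B i \<in> sets borel" if "i \<in> I" for i
      using measurable_sets_borel[of "(*v) A" borel "B i"] B[OF that] by simp
    have "?T -` Pi\<^sub>E I B \<inter> space ?M = Pi\<^sub>E I (\<lambda>i. (*v) A -` B i)"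
      by (auto simp: space_PiM PiE_def Pi_def extensional_def)
    then have "emeasure (density (distr ?M ?M ?T) (\<lambda>_. ennreal (\<bar>det A\<bar> ^ card I))) (Pi\<^sub>E I B)
        = ennreal (\<bar>det A\<bar> ^ card I) * (\<Prod>i\<in>I. emeasure lborel ((*v) A -` B i))"
      using B B' \<open>finite I\<close> by (simp add: emeasure_density_const emeasure_distr sets_PiM_I_finite lborel_product.emeasure_PiM)
    also have "\<dots> = (\<Prod>i\<in>I. ennreal \<bar>det A\<bar> * emeasure lborel ((*v) A -` B i))"
      by (simp add: prod.distrib ennreal_power)
    also have "\<dots> = (\<Prod>i\<in>I. emeasure lborel (B i))"
    proof (rule prod.cong[OF refl])
      fix i assume i: "i \<in> I"
      then have [measurable]: "B i \<in> sets borel" using B by simp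
      have "(\<integral>\<^sup>+x. indicator (B i) (A *v x) \<partial>lborel) = (\<integral>\<^sup>+x. indicator ((*v) A -` B i) x \<partial>lborel)"
        by (intro nn_integral_cong) (simp add: indicator_def)
      then show "ennreal \<bar>det A\<bar> * emeasure lborel ((*v) A -` B i) = emeasure lborel (B i)"
        using nn_integral_lborel_matrix_vector[OF A, of "indicator (B i)"] B'[OF i] by simp
    qed
    finally show "emeasure (density (distr ?M ?M ?T) (\<lambda>_. ennreal (\<bar>det A\<bar> ^ card I))) (Pi\<^sub>E I B)
       = (\<Prod>i\<in>I. emeasure lborel (B i))" .
  qed (use \<open>finite I\<close> in simp_all)
  then have "(\<integral>\<^sup>+x. f x \<partial>?M) = (\<integral>\<^sup>+x. f x \<partial>density (distr ?M ?M ?T) (\<lambda>_. ennreal (\<bar>det A\<bar> ^ card I)))"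
    by simp
  also have "\<dots> = ennreal (\<bar>det A\<bar> ^ card I) * (\<integral>\<^sup>+x. f (?T x) \<partial>?M)"
    by (simp add: nn_integral_density nn_integral_distr nn_integral_cmult)
  finally show ?thesis by simp
qed

lemma nn_integral_lborel_columns:
  fixes f :: "real^'n^'m \<Rightarrow> ennreal"
  assumes [measurable]: "f \<in> borel_measurable borel"
  shows "(\<integral>\<^sup>+X. f X \<partial>lborel) = (\<integral>\<^sup>+x. f (transpose (vec_lambda x)) \<partial>PiM UNIV (\<lambda>_. lborel))"
  by (subst nn_integral_lborel_transpose[symmetric]) (auto simp: nn_integral_lborel_vec)

text \<open>Left multiplication acts on each of the \<open>CARD('m)\<close> columns separately,
  hence the exponent.\<close>

lemma nn_integral_lborel_matrix_left:
  fixes A :: "real^'n^'n" and f :: "real^'m^'n \<Rightarrow> ennreal"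
  assumes A: "det A \<noteq> 0" and [measurable]: "f \<in> borel_measurable borel"
  shows "ennreal (\<bar>det A\<bar> ^ CARD('m)) * (\<integral>\<^sup>+X. f (A ** X) \<partial>lborel) = (\<integral>\<^sup>+X. f X \<partial>lborel)"
proof -
  have "A ** transpose (vec_lambda x) = transpose (vec_lambda (\<lambda>i\<in>UNIV. A *v x i))" for x :: "'m \<Rightarrow> _"
    by (simp add: vec_eq_iff transpose_def matrix_matrix_mult_def matrix_vector_mult_def)
  then show ?thesis
    using nn_integral_PiM_lborel_matrix_vector[OF _ A, of UNIV "\<lambda>x. f (transpose (vec_lambda x))"]
    by (simp add: nn_integral_lborel_columns)
qed

text \<open>Transposition preserves Lebesgue measure and exchanges right and left multiplication, so
  that rows take the role of columns.\<close>

lemma nn_integral_lborel_matrix_right: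
  fixes A :: "real^'m^'m" and f :: "real^'m^'n \<Rightarrow> ennreal"
  assumes A: "det A \<noteq> 0" and [measurable]: "f \<in> borel_measurable borel"
  shows "ennreal (\<bar>det A\<bar> ^ CARD('n)) * (\<integral>\<^sup>+X. f (X ** A) \<partial>lborel) = (\<integral>\<^sup>+X. f X \<partial>lborel)"
proof -
  have "(\<integral>\<^sup>+X. f (X ** A) \<partial>lborel) = (\<integral>\<^sup>+X. f (transpose X ** A) \<partial>lborel)"
    using nn_integral_lborel_transpose[of "\<lambda>X. f (X ** A)"] by simp
  also have "\<dots> = (\<integral>\<^sup>+X. f (transpose (transpose A ** X)) \<partial>lborel)"
    by (simp add: matrix_transpose_mul)
  finally show ?thesis
    using nn_integral_lborel_matrix_left[of "transpose A" "\<lambda>X. f (transpose X)"] A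
    by (simp add: nn_integral_lborel_transpose)
qed

text \<open>Passage from families of vectors to matrices: \<open>e\<close> labels the members of the
  family by column indices. It makes right multiplication by orthogonal matrices available for a
  sample indexed by natural numbers.\<close>

lemma PiM_lborel_eq_distr_columns:
  fixes e :: "'m::finite \<Rightarrow> 'i"
  assumes e: "bij_betw e UNIV I"
  shows "PiM I (\<lambda>_. lborel :: (real^'n) measure) =
     distr (lborel :: (real^'m^'n) measure) (PiM I (\<lambda>_. lborel)) (\<lambda>X. \<lambda>i\<in>I. column (inv e i) X)"
    (is "?M = distr _ _ ?c")
proof (rule lborel_product.PiM_eqI[symmetric])
  have inj: "inj e" and I: "I = range e" using e by (auto simp: bij_betw_def)
  then show "finite I" by simp
  have c [measurable]: "?c \<in> lborel \<rightarrow>\<^sub>M ?M"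
    unfolding column_def by measurable
  fix A :: "'i \<Rightarrow> (real^'n) set" assume A: "\<And>i. i \<in> I \<Longrightarrow> A i \<in> sets lborel"
  have A' [measurable]: "A (e j) \<in> sets borel" for j using A[of "e j"] I by simp
  have PA: "Pi\<^sub>E I A \<in> sets ?M" using A \<open>finite I\<close> by (intro sets_PiM_I_finite) auto
  have "emeasure (distr lborel ?M ?c) (Pi\<^sub>E I A) = (\<integral>\<^sup>+x. indicator (Pi\<^sub>E I A) x \<partial>distr lborel ?M ?c)"
    using PA by simp
  also have "\<dots> = (\<integral>\<^sup>+X. indicator (Pi\<^sub>E I A) (?c X) \<partial>lborel)"
    using PA by (intro nn_integral_distr c) auto
  also have "\<dots> = (\<integral>\<^sup>+x. indicator (Pi\<^sub>E I A) (?c (transpose (vec_lambda x))) \<partial>PiM UNIV (\<lambda>_. lborel))"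
    using PA by (intro nn_integral_lborel_columns) (use c in simp)
  also have "\<dots> = (\<integral>\<^sup>+x. indicator (Pi\<^sub>E UNIV (\<lambda>j. A (e j))) x \<partial>PiM UNIV (\<lambda>_. lborel))"
  proof (intro nn_integral_cong)
    fix x :: "'m \<Rightarrow> real^'n"
    have "?c (transpose (vec_lambda x)) = (\<lambda>i\<in>I. x (inv e i))"
      by (simp add: column_def transpose_def)
    moreover have "(\<forall>i\<in>I. x (inv e i) \<in> A i) \<longleftrightarrow> (\<forall>j. x j \<in> A (e j))"
      unfolding I using inj by simp
    ultimately have "?c (transpose (vec_lambda x)) \<in> Pi\<^sub>E I A \<longleftrightarrow> x \<in> Pi\<^sub>E UNIV (\<lambda>j. A (e j))"
      by (simp add: PiE_iff)
    then show "indicator (Pi\<^sub>E I A) (?c (transpose (vec_lambda x))) =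
        (indicator (Pi\<^sub>E UNIV (\<lambda>j. A (e j))) x :: ennreal)"
      by (simp add: indicator_def)
  qed
  also have "\<dots> = emeasure (PiM UNIV (\<lambda>_. lborel)) (Pi\<^sub>E UNIV (\<lambda>j. A (e j)))"
    by (intro nn_integral_indicator sets_PiM_I_finite) auto
  also have "\<dots> = (\<Prod>j\<in>UNIV. emeasure lborel (A (e j)))"
    by (intro lborel_product.emeasure_PiM) auto
  also have "\<dots> = (\<Prod>i\<in>I. emeasure lborel (A i))"
    using prod.reindex_bij_betw[OF e] by simp
  finally show "emeasure (distr lborel ?M ?c) (Pi\<^sub>E I A) = (\<Prod>i\<in>I. emeasure lborel (A i))" .
qed simp

text \<open>\<open>q\<close> is \<open>det (mat 1 + s X)\<close> as a polynomial in
  \<open>s\<close>; its value 1 at 0 shows at once that it is not zero. A nonzero \<open>t\<close>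
  for which \<open>X + t I\<close> is singular is the inverse of a root of \<open>q\<close>.\<close>

lemma finite_det_add_scaleR_mat_1_zero:
  fixes X :: "real^'n^'n"
  shows "finite {t. det (X + t *\<^sub>R mat 1) = 0}"
proof -
  define q where "q = (\<Sum>p | p permutes UNIV. of_int (sign p) *
     (\<Prod>i\<in>UNIV. [:mat 1 $ i $ p i, X $ i $ p i:]) :: real poly)"
  have q: "poly q s = det (mat 1 + s *\<^sub>R X)" for s
    by (simp add: q_def det_def poly_sum poly_prod)
  have "poly q 0 \<noteq> 0" by (simp add: q)
  then have "q \<noteq> 0" by auto
  then have fin: "finite {s. poly q s = 0}" by (rule poly_roots_finite)
  have "inverse t \<in> {s. poly q s = 0}" if "det (X + t *\<^sub>R mat 1) = 0" "t \<noteq> 0" for t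
  proof (rule ccontr)
    assume "inverse t \<notin> {s. poly q s = 0}"
    then have "invertible (mat 1 + inverse t *\<^sub>R X)"
      by (simp add: invertible_det_nz q)
    then have "invertible (t *\<^sub>R (mat 1 + inverse t *\<^sub>R X))"
      using that(2) by (intro scalar_invertible)
    also have "t *\<^sub>R (mat 1 + inverse t *\<^sub>R X) = X + t *\<^sub>R mat 1"
      using that(2) by (simp add: scaleR_add_right add.commute)
    finally show False using that(1) by (simp add: invertible_det_nz)
  qed
  then have "{t. det (X + t *\<^sub>R mat 1) = 0} \<subseteq> insert 0 (inverse ` {s. poly q s = 0})"
    by (auto simp: image_iff) (metis inverse_inverse_eq)
  with fin show ?thesis by (meson finite_imageI finite_insert finite_subset)
qed

text \<open>By translation invariance the set of singular matrices has the same measure as its translate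
  along \<open>t I\<close>, and almost no \<open>t\<close> makes \<open>X + t I\<close> singular.\<close>
lemma AE_lborel_det_nz: "AE X in (lborel :: (real^'n^'n) measure). det X \<noteq> 0"
proof -
  let ?N = "{X :: real^'n^'n. det X = 0}"
  have N [measurable]: "?N \<in> sets borel" by measurable
  have "emeasure lborel ?N = (\<integral>\<^sup>+t. emeasure lborel ?N * indicator {0..1} t \<partial>(lborel :: real measure))"
    by (simp add: nn_integral_cmult)
  also have "\<dots> = (\<integral>\<^sup>+t. (\<integral>\<^sup>+X. indicator ?N (X + t *\<^sub>R mat 1) * indicator {0..1} t \<partial>lborel) \<partial>(lborel :: real measure))"
  proof (intro nn_integral_cong)
    fix t :: real
    have "emeasure lborel ?N = (\<integral>\<^sup>+X. indicator ?N X \<partial>distr lborel borel ((+) (t *\<^sub>R mat 1)))"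
      by (simp add: lborel_distr_plus)
    also have "\<dots> = (\<integral>\<^sup>+X. indicator ?N (X + t *\<^sub>R mat 1) \<partial>lborel)"
      by (subst nn_integral_distr) (simp_all add: add.commute)
    finally show "emeasure lborel ?N * indicator {0..1} t
        = (\<integral>\<^sup>+X. indicator ?N (X + t *\<^sub>R mat 1) * indicator {0..1} t \<partial>lborel)"
      by (simp add: nn_integral_multc)
  qed
  also have "\<dots> = (\<integral>\<^sup>+X. (\<integral>\<^sup>+t. indicator ?N (X + t *\<^sub>R mat 1) * indicator {0..1} t \<partial>(lborel :: real measure)) \<partial>lborel)"
    by (rule lborel_pair.Fubini') measurable
  also have "\<dots> = (\<integral>\<^sup>+(X::real^'n^'n). 0 \<partial>lborel)"
  proof (intro nn_integral_cong)
    fix X :: "real^'n^'n"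
    have "AE t in (lborel :: real measure). t \<notin> {t. det (X + t *\<^sub>R mat 1) = 0}"
      by (intro AE_not_in finite_imp_null_set_lborel finite_det_add_scaleR_mat_1_zero)
    then have "(\<integral>\<^sup>+t. indicator ?N (X + t *\<^sub>R mat 1) * indicator {0..1} t \<partial>(lborel :: real measure)) = (\<integral>\<^sup>+t. 0 \<partial>(lborel :: real measure))"
      by (intro nn_integral_cong_AE) (auto elim!: eventually_mono simp: indicator_def)
    then show "(\<integral>\<^sup>+t. indicator ?N (X + t *\<^sub>R mat 1) * indicator {0..1} t \<partial>(lborel :: real measure)) = 0"
      by simp
  qed
  finally have "?N \<in> null_sets lborel" by (simp add: null_setsI)
  then show ?thesis by (auto dest: AE_not_in)
qed

subsection \<open>Gaussian measures\<close>

lemma PiM_density: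
  assumes "product_sigma_finite M" "finite I"
    and f [measurable]: "\<And>i. f i \<in> borel_measurable (M i)"
    and sf: "\<And>i. sigma_finite_measure (density (M i) (f i))"
  shows "PiM I (\<lambda>i. density (M i) (f i)) = density (PiM I M) (\<lambda>x. \<Prod>i\<in>I. f i (x i))"
proof -
  interpret M: product_sigma_finite M by fact
  interpret D: product_sigma_finite "\<lambda>i. density (M i) (f i)"
    by (simp add: product_sigma_finite_def sf)
  have sets: "sets (PiM I (\<lambda>i. density (M i) (f i))) = sets (PiM I M)"
    by (intro sets_PiM_cong) auto
  have "density (PiM I M) (\<lambda>x. \<Prod>i\<in>I. f i (x i)) = PiM I (\<lambda>i. density (M i) (f i))"
  proof (rule D.PiM_eqI[OF \<open>finite I\<close>])
    fix A assume A: "\<And>i. i \<in> I \<Longrightarrow> A i \<in> sets (density (M i) (f i))"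
    then have A' [measurable]: "i \<in> I \<Longrightarrow> A i \<in> sets (M i)" for i by simp
    have PA: "Pi\<^sub>E I A \<in> sets (PiM I M)"
      using A \<open>finite I\<close> by (intro sets_PiM_I_finite) auto
    have "emeasure (density (PiM I M) (\<lambda>x. \<Prod>i\<in>I. f i (x i))) (Pi\<^sub>E I A)
        = (\<integral>\<^sup>+x. (\<Prod>i\<in>I. f i (x i)) * indicator (Pi\<^sub>E I A) x \<partial>PiM I M)"
      using PA by (subst emeasure_density) auto
    also have "\<dots> = (\<integral>\<^sup>+x. (\<Prod>i\<in>I. f i (x i) * indicator (A i) (x i)) \<partial>PiM I M)"
    proof (intro nn_integral_cong)
      fix x assume "x \<in> space (PiM I M)"
      then have "x \<in> extensional I" by (simp add: space_PiM PiE_def)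
      then have "indicator (Pi\<^sub>E I A) x = (\<Prod>i\<in>I. indicator (A i) (x i) :: ennreal)"
        using \<open>finite I\<close> by (auto simp: indicator_def PiE_iff prod_zero_iff)
      then show "(\<Prod>i\<in>I. f i (x i)) * indicator (Pi\<^sub>E I A) x = (\<Prod>i\<in>I. f i (x i) * indicator (A i) (x i))"
        by (simp add: prod.distrib)
    qed
    also have "\<dots> = (\<Prod>i\<in>I. \<integral>\<^sup>+x. f i x * indicator (A i) x \<partial>M i)"
      using \<open>finite I\<close> by (intro M.product_nn_integral_prod) auto
    also have "\<dots> = (\<Prod>i\<in>I. emeasure (density (M i) (f i)) (A i))"
      by (intro prod.cong refl, subst emeasure_density) auto
    finally show "emeasure (density (PiM I M) (\<lambda>x. \<Prod>i\<in>I. f i (x i))) (Pi\<^sub>E I A)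
        = (\<Prod>i\<in>I. emeasure (density (M i) (f i)) (A i))" .
  qed (simp add: sets)
  then show ?thesis by simp
qed

abbreviation "std_normal \<equiv> density lborel (\<lambda>x. ennreal (std_normal_density x))"

lemma prob_space_std_normal: "prob_space std_normal"
  using prob_space_normal_density[of 1 0] by simp

lemma std_normal_moment:
  shows "integrable std_normal (\<lambda>x. x ^ k)"
    and "integral\<^sup>L std_normal (\<lambda>x. x) = 0"
    and "integral\<^sup>L std_normal (\<lambda>x. x * x) = 1"
proof -
  show "integrable std_normal (\<lambda>x. x ^ k)"
    using integrable_std_normal_moment[of k] by (simp add: integrable_density)
  show "integral\<^sup>L std_normal (\<lambda>x. x) = 0"
    using integral_std_normal_moment_odd[of 0] by (simp add: integral_density)
  show "integral\<^sup>L std_normal (\<lambda>x. x * x) = 1"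
    using integral_std_normal_moment_even[of 1]
    by (simp add: integral_density power2_eq_square fact_numeral)
qed

lemma matrix_inv_mult_transpose:
  fixes T :: "real^'n^'n"
  assumes "det T \<noteq> 0"
  shows "matrix_inv (T ** transpose T) = transpose (matrix_inv T) ** matrix_inv T"
proof (rule matrix_inv_unique)
  have "T ** transpose T ** (transpose (matrix_inv T) ** matrix_inv T)
      = T ** transpose (matrix_inv T ** T) ** matrix_inv T"
    by (simp add: matrix_transpose_mul matrix_mul_assoc)
  then show "T ** transpose T ** (transpose (matrix_inv T) ** matrix_inv T) = mat 1"
    using assms by (simp add: matrix_inv_mult transpose_mat)
qed

lemma borel_measurable_gauss_density [measurable]: "gauss_density S \<in> borel_measurable borel"
proof -
  have "(\<lambda>x. gauss_density S x) \<in> borel_measurable borel"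
    unfolding gauss_density_def matrix_vector_mult_def by measurable
  then show ?thesis by simp
qed

text \<open>Change of variables \<open>x = T z\<close>: the quadratic form becomes the squared norm
  of \<open>z\<close>, and the Jacobian \<bar>det T\<bar> cancels the determinant in the
  normalisation.\<close>

lemma gauss_density_mult_vector:
  fixes T :: "real^'n^'n"
  assumes T: "det T \<noteq> 0"
  shows "\<bar>det T\<bar> * gauss_density (T ** transpose T) (T *v z) = (\<Prod>i\<in>UNIV. std_normal_density (z $ i))"
proof -
  have "(T *v z) \<bullet> (matrix_inv (T ** transpose T) *v (T *v z))
      = (T *v z) \<bullet> (transpose (matrix_inv T) *v (matrix_inv T *v (T *v z)))"
    by (simp add: matrix_inv_mult_transpose[OF T] matrix_vector_mul_assoc matrix_mul_assoc del: transpose_matrix_vector)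
  also have "\<dots> = (matrix_inv T *v (T *v z)) \<bullet> (matrix_inv T *v (T *v z))"
    by (metis dot_lmul_matrix inner_commute transpose_matrix_vector)
  also have "\<dots> = (\<Sum>i\<in>UNIV. (z $ i)\<^sup>2)"
    by (simp add: matrix_vector_mul_assoc matrix_inv_mult T inner_vec_def power2_eq_square)
  finally have "exp (- ((T *v z) \<bullet> (matrix_inv (T ** transpose T) *v (T *v z))) / 2) = (\<Prod>i\<in>UNIV. exp (- (z $ i)\<^sup>2 / 2))"
    by (simp add: exp_sum[symmetric] sum_negf sum_divide_distrib)
  moreover have "sqrt ((2 * pi) ^ CARD('n) * det (T ** transpose T)) = sqrt (2 * pi) ^ CARD('n) * \<bar>det T\<bar>"
    by (simp add: det_mul real_sqrt_mult real_sqrt_power power_mult_distrib)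
  ultimately show ?thesis
    using T by (simp add: gauss_density_def std_normal_density_def prod.distrib prod_dividef power_one_over field_simps)
qed

text \<open>A centred Gaussian vector is a linear image of independent standard normals. With
  \<open>T = chol S\<close> this yields the total mass and the covariance of
  \<open>gaussian S\<close>.\<close>

lemma gaussian_eq_distr_std_normal:
  fixes T :: "real^'n^'n"
  assumes T: "det T \<noteq> 0"
  shows "gaussian (T ** transpose T) =
    distr (PiM UNIV (\<lambda>_. std_normal)) borel (\<lambda>z. T *v vec_lambda z)"
proof (rule measure_eqI)
  have [measurable]: "(\<lambda>z. T *v vec_lambda z) \<in> borel_measurable (PiM UNIV (\<lambda>_. std_normal))"
    by measurable
  fix A assume "A \<in> sets (gaussian (T ** transpose T))"
  then have [measurable]: "A \<in> sets borel" by (simp add: gaussian_def)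
  let ?g = "gauss_density (T ** transpose T)"
  have "emeasure (gaussian (T ** transpose T)) A = (\<integral>\<^sup>+x. ennreal (?g x) * indicator A x \<partial>lborel)"
    unfolding gaussian_def by (subst emeasure_density) auto
  also have "\<dots> = ennreal \<bar>det T\<bar> * (\<integral>\<^sup>+z. ennreal (?g (T *v z)) * indicator A (T *v z) \<partial>lborel)"
    by (rule nn_integral_lborel_matrix_vector[OF T, symmetric]) measurable
  also have "\<dots> = (\<integral>\<^sup>+z. ennreal \<bar>det T\<bar> * (ennreal (?g (T *v z)) * indicator A (T *v z)) \<partial>lborel)"
    by (subst nn_integral_cmult) auto
  also have "\<dots> = (\<integral>\<^sup>+z. (\<Prod>i\<in>UNIV. ennreal (std_normal_density (z $ i))) * indicator A (T *v z) \<partial>lborel)"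
    by (simp add: prod_ennreal gauss_density_mult_vector[OF T, symmetric] ennreal_mult' mult.assoc)
  also have "\<dots> = (\<integral>\<^sup>+z. (\<Prod>i\<in>UNIV. ennreal (std_normal_density (z i))) * indicator A (T *v vec_lambda z)
      \<partial>PiM UNIV (\<lambda>_. lborel))"
    by (subst nn_integral_lborel_vec) (auto)
  also have "\<dots> = (\<integral>\<^sup>+z. indicator A (T *v vec_lambda z)
      \<partial>density (PiM UNIV (\<lambda>_. lborel)) (\<lambda>z. \<Prod>i\<in>UNIV. ennreal (std_normal_density (z i))))"
    by (subst nn_integral_density) auto
  also have "density (PiM UNIV (\<lambda>_. lborel)) (\<lambda>z. \<Prod>i\<in>UNIV. ennreal (std_normal_density (z i)))
      = PiM UNIV (\<lambda>_::'n. std_normal)"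
    by (rule PiM_density[symmetric])
      (auto simp: product_sigma_finite_lborel prob_space_std_normal prob_space_imp_sigma_finite)
  also have "(\<integral>\<^sup>+z. indicator A (T *v vec_lambda z) \<partial>PiM UNIV (\<lambda>_::'n. std_normal))
      = (\<integral>\<^sup>+x. indicator A x \<partial>distr (PiM UNIV (\<lambda>_. std_normal)) borel (\<lambda>z. T *v vec_lambda z))"
    by (subst nn_integral_distr) auto
  finally show "emeasure (gaussian (T ** transpose T)) A =
      emeasure (distr (PiM UNIV (\<lambda>_. std_normal)) borel (\<lambda>z. T *v vec_lambda z)) A"
    by simp
qed (simp add: gaussian_def)

lemma integral_PiM_std_normal_mult:
  shows "integrable (PiM UNIV (\<lambda>_::'n::finite. std_normal)) (\<lambda>z. z k * z l)"
    and "integral\<^sup>L (PiM UNIV (\<lambda>_::'n::finite. std_normal)) (\<lambda>z. z k * z l) = (if k = l then 1 else 0)"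
proof -
  interpret N: prob_space std_normal by (rule prob_space_std_normal)
  interpret P: product_prob_space "\<lambda>_::'n. std_normal" ..
  \<comment> \<open>The exponents write \<open>z k * z l\<close> as a product over all coordinates,
    for \<open>k = l\<close> as well as for \<open>k \<noteq> l\<close>, so that its integral
    factorises.\<close>
  define h :: "'n \<Rightarrow> real \<Rightarrow> real" where "h c z = z ^ (of_bool (c = k) + of_bool (c = l))" for c z
  have h: "(\<Prod>c\<in>UNIV. h c (z c)) = z k * z l" for z
    by (simp add: h_def power_add prod.distrib of_bool_def if_distrib[of "\<lambda>n. _ ^ n"] cong: if_cong)
  have int: "integrable std_normal (h c)" for c
    unfolding h_def[abs_def] by (rule std_normal_moment)
  show "integrable (PiM UNIV (\<lambda>_. std_normal)) (\<lambda>z. z k * z l)"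
    using P.product_integrable_prod[of UNIV h] int h by simp
  have "integral\<^sup>L (PiM UNIV (\<lambda>_. std_normal)) (\<lambda>z. z k * z l) = (\<Prod>c\<in>UNIV. integral\<^sup>L std_normal (h c))"
    using P.product_integral_prod[of UNIV h] int h by simp
  also have "\<dots> = (if k = l then 1 else 0)"
  proof (cases "k = l")
    case True
    then have "integral\<^sup>L std_normal (h c) = 1" for c
      by (cases "c = k") (simp_all add: h_def[abs_def] std_normal_moment N.prob_space[simplified] power2_eq_square)
    with True show ?thesis by simp
  next
    case False
    then have "integral\<^sup>L std_normal (h k) = 0"
      by (simp add: h_def[abs_def] std_normal_moment)
    with False show ?thesis by (auto intro!: prod_zero)
  qed
  finally show "integral\<^sup>L (PiM UNIV (\<lambda>_. std_normal)) (\<lambda>z. z k * z l) = (if k = l then 1 else 0)" .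
qed

section \<open>Mass, covariance and expected Gram determinant of a Gaussian law\<close>

context
  fixes S :: "real^'d::{finite,linorder}^'d::{finite,linorder}"
  assumes S: "pos_def_mat S"
begin

lemma gaussian_eq_distr_chol:
  "gaussian S = distr (PiM UNIV (\<lambda>_. std_normal)) borel (\<lambda>z. chol S *v vec_lambda z)"
  using gaussian_eq_distr_std_normal[OF det_chol_nz[OF S]] by (simp add: chol_mult_transpose S)

lemma prob_space_gaussian: "prob_space (gaussian S)"
proof -
  have "prob_space (PiM UNIV (\<lambda>_::'d. std_normal))"
    by (intro prob_space_PiM prob_space_std_normal)
  then show ?thesis
    unfolding gaussian_eq_distr_chol by (rule prob_space.prob_space_distr) measurable
qed

lemma gaussian_covariance:
  shows "integrable (gaussian S) (\<lambda>x. x $ a * x $ b)"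
    and "integral\<^sup>L (gaussian S) (\<lambda>x. x $ a * x $ b) = S $ a $ b"
proof -
  let ?P = "PiM UNIV (\<lambda>_::'d. std_normal)"
  let ?T = "chol S"
  have [measurable]: "(\<lambda>z. ?T *v vec_lambda z) \<in> borel_measurable ?P" by measurable
  have eq: "(?T *v vec_lambda z) $ a * (?T *v vec_lambda z) $ b
      = (\<Sum>k\<in>UNIV. \<Sum>l\<in>UNIV. (?T $ a $ k * ?T $ b $ l) * (z k * z l))" for z
    by (simp add: matrix_vector_mult_def sum_product ac_simps)
  show "integrable (gaussian S) (\<lambda>x. x $ a * x $ b)"
    unfolding gaussian_eq_distr_chol by (subst integrable_distr_eq)
      (auto simp: eq intro!: Bochner_Integration.integrable_sum integral_PiM_std_normal_mult)
  have "integral\<^sup>L (gaussian S) (\<lambda>x. x $ a * x $ b)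
      = integral\<^sup>L ?P (\<lambda>z. (?T *v vec_lambda z) $ a * (?T *v vec_lambda z) $ b)"
    unfolding gaussian_eq_distr_chol by (subst integral_distr) auto
  also have "\<dots> = (\<Sum>k\<in>UNIV. \<Sum>l\<in>UNIV. (?T $ a $ k * ?T $ b $ l) * (if k = l then 1 else 0))"
    unfolding eq by (subst Bochner_Integration.integral_sum |
       simp add: integral_PiM_std_normal_mult Bochner_Integration.integrable_sum)+
  also have "\<dots> = (?T ** transpose ?T) $ a $ b"
    by (simp add: matrix_matrix_mult_def transpose_def if_distrib cong: if_cong)
  finally show "integral\<^sup>L (gaussian S) (\<lambda>x. x $ a * x $ b) = S $ a $ b"
    by (simp add: chol_mult_transpose S)
qed

text \<open>The determinant of the Gram matrix is a square, and the Leibniz formula is applied to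
  both factors. Independence turns the mean of each term into a product of covariances. For fixed
  \<open>p\<close> the sum over \<open>q\<close> is \<open>sign p * det S\<close>, the outer sign
  squares it away, and each of the \<open>d!\<close> permutations \<open>p\<close> contributes
  \<open>det S\<close>. The result is the normalising constant of \<open>VS\<close>.\<close>

lemma nn_integral_gaussian_det:
  fixes e :: "'d \<Rightarrow> 'i"
  assumes e: "bij_betw e UNIV I"
  shows "(\<integral>\<^sup>+x. ennreal (det (\<Sum>i\<in>I. outer (x i))) \<partial>PiM I (\<lambda>_. gaussian S)) = ennreal (fact CARD('d) * det S)"
proof -
  have inj: "inj e" and I: "I = range e" using e by (auto simp: bij_betw_def)
  then have fin: "finite I" by simp
  interpret G: prob_space "gaussian S" by (rule prob_space_gaussian)
  interpret P: product_prob_space "\<lambda>_::'i. gaussian S" ..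
  let ?P = "PiM I (\<lambda>_. gaussian S)"
  \<comment> \<open>The vectors are the rows of \<open>?Y\<close>, so a term of the Leibniz formula
    picks one coordinate from each vector and factorises over the sample.\<close>
  let ?Y = "\<lambda>x. \<chi> b. x (e b)"
  let ?f = "\<lambda>p q i v. v $ p (inv e i) * v $ q (inv e i) :: real"
  have gram: "(\<Sum>i\<in>I. outer (x i)) = transpose (?Y x) ** ?Y x" for x
    using sum.reindex_bij_betw[OF e, of "\<lambda>i. outer (x i)"]
    by (simp add: vec_eq_iff matrix_matrix_mult_def transpose_def outer_def flip: sum.reindex_bij_betw[OF e])
  have det_eq: "det (\<Sum>i\<in>I. outer (x i)) = (\<Sum>p | p permutes UNIV. \<Sum>q | q permutes UNIV.
      (of_int (sign p) * of_int (sign q)) * (\<Prod>i\<in>I. ?f p q i (x i)))" for x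
  proof -
    have "(\<Prod>i\<in>I. ?f p q i (x i)) = (\<Prod>b\<in>UNIV. x (e b) $ p b) * (\<Prod>b\<in>UNIV. x (e b) $ q b)" for p q :: "'d \<Rightarrow> 'd"
      using inj by (simp add: prod.distrib flip: prod.reindex_bij_betw[OF e])
    then show ?thesis
      unfolding gram det_mul det_transpose det_def[of "?Y x"] by (simp add: sum_product ac_simps)
  qed
  have int: "integrable ?P (\<lambda>x. \<Prod>i\<in>I. ?f p q i (x i))"
    and val: "integral\<^sup>L ?P (\<lambda>x. \<Prod>i\<in>I. ?f p q i (x i)) = (\<Prod>b\<in>UNIV. S $ p b $ q b)" for p q
  proof -
    show "integrable ?P (\<lambda>x. \<Prod>i\<in>I. ?f p q i (x i))"
      by (intro P.product_integrable_prod fin gaussian_covariance)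
    have "integral\<^sup>L ?P (\<lambda>x. \<Prod>i\<in>I. ?f p q i (x i)) = (\<Prod>i\<in>I. integral\<^sup>L (gaussian S) (?f p q i))"
      by (intro P.product_integral_prod fin gaussian_covariance)
    then show "integral\<^sup>L ?P (\<lambda>x. \<Prod>i\<in>I. ?f p q i (x i)) = (\<Prod>b\<in>UNIV. S $ p b $ q b)"
      using inj by (simp add: gaussian_covariance flip: prod.reindex_bij_betw[OF e])
  qed
  have "integral\<^sup>L ?P (\<lambda>x. det (\<Sum>i\<in>I. outer (x i))) = (\<Sum>p | p permutes UNIV. \<Sum>q | q permutes UNIV.
      (of_int (sign p) * of_int (sign q)) * (\<Prod>b\<in>UNIV. S $ p b $ q b))"
    unfolding det_eq by (subst Bochner_Integration.integral_sum | simp add: int val)+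
  also have "\<dots> = (\<Sum>p | p permutes (UNIV::'d set). of_int (sign p) * det (\<chi> b. S $ p b))"
    by (simp add: det_def sum_distrib_left mult.assoc)
  also have "\<dots> = (\<Sum>p | p permutes (UNIV::'d set). det S)"
    by (intro sum.cong refl) (simp add: det_permute_rows sign_idempotent mult.assoc[symmetric] flip: of_int_mult)
  also have "\<dots> = fact CARD('d) * det S"
    by (simp add: card_permutations)
  finally have "integral\<^sup>L ?P (\<lambda>x. det (\<Sum>i\<in>I. outer (x i))) = fact CARD('d) * det S" .
  moreover have "integrable ?P (\<lambda>x. det (\<Sum>i\<in>I. outer (x i)))"
    unfolding det_eq by (intro Bochner_Integration.integrable_sum integrable_mult_right int)
  moreover have "det (\<Sum>i\<in>I. outer (x i)) \<ge> 0" for x :: "'i \<Rightarrow> (real, 'd) vec"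
    unfolding gram by (simp add: det_mul)
  ultimately show ?thesis by (subst nn_integral_eq_integral) auto
qed

end

text \<open>Joint Lebesgue density of \<open>n\<close> independent \<open>gaussian S\<close> vectors
  as a function of their Gram matrix \<open>w\<close>; the double sum is the trace of
  \<open>matrix_inv S ** transpose w\<close>.\<close>

definition gauss_weight :: "real^'n^'n \<Rightarrow> nat \<Rightarrow> real^'n^'n \<Rightarrow> real" where
  "gauss_weight S n w = exp (- (\<Sum>a\<in>UNIV. \<Sum>b\<in>UNIV. matrix_inv S $ a $ b * w $ a $ b) / 2)
     / sqrt ((2 * pi) ^ CARD('n) * det S) ^ n"

lemma borel_measurable_gauss_weight [measurable]: "gauss_weight S n \<in> borel_measurable borel"
proof -
  have "(\<lambda>w. gauss_weight S n w) \<in> borel_measurable borel"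
    unfolding gauss_weight_def by measurable
  then show ?thesis by simp
qed

lemma gauss_weight_nonneg: "det S \<ge> 0 \<Longrightarrow> gauss_weight S n w \<ge> 0"
  by (simp add: gauss_weight_def)

lemma prod_gauss_density:
  assumes "finite J"
  shows "(\<Prod>j\<in>J. gauss_density S (y j)) = gauss_weight S (card J) (\<Sum>j\<in>J. outer (y j))"
proof -
  have "(\<Sum>a\<in>UNIV. \<Sum>b\<in>UNIV. matrix_inv S $ a $ b * (\<Sum>j\<in>J. outer (y j)) $ a $ b)
      = (\<Sum>a\<in>UNIV. \<Sum>j\<in>J. \<Sum>b\<in>UNIV. matrix_inv S $ a $ b * (y j $ a * y j $ b))"
    by (simp add: outer_def sum_distrib_left sum.swap[of _ J])
  also have "\<dots> = (\<Sum>j\<in>J. \<Sum>a\<in>UNIV. \<Sum>b\<in>UNIV. matrix_inv S $ a $ b * (y j $ a * y j $ b))"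
    by (rule sum.swap)
  also have "\<dots> = (\<Sum>j\<in>J. y j \<bullet> (matrix_inv S *v y j))"
    by (simp add: inner_vec_def matrix_vector_mult_def sum_distrib_left ac_simps)
  finally have "exp (- (\<Sum>a\<in>UNIV. \<Sum>b\<in>UNIV. matrix_inv S $ a $ b * (\<Sum>j\<in>J. outer (y j)) $ a $ b) / 2)
      = (\<Prod>j\<in>J. exp (- (y j \<bullet> (matrix_inv S *v y j)) / 2))"
    using assms by (simp add: exp_sum[symmetric] sum_negf sum_divide_distrib)
  then show ?thesis
    by (simp add: gauss_density_def gauss_weight_def prod_dividef)
qed

lemma PiM_gaussian:
  fixes S :: "real^'d::{finite,linorder}^'d::{finite,linorder}"
  assumes S: "pos_def_mat S" and "finite J"
  shows "PiM J (\<lambda>_. gaussian S) =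
    density (PiM J (\<lambda>_. lborel)) (\<lambda>y. ennreal (gauss_weight S (card J) (\<Sum>j\<in>J. outer (y j))))"
proof -
  have nonneg: "gauss_density S x \<ge> 0" for x
    using pos_def_mat_det_pos[OF S] by (simp add: gauss_density_def)
  have "PiM J (\<lambda>_. gaussian S) = density (PiM J (\<lambda>_. lborel)) (\<lambda>y. \<Prod>j\<in>J. ennreal (gauss_density S (y j)))"
    unfolding gaussian_def
    by (rule PiM_density) (use assms prob_space_gaussian[OF S] in
      \<open>auto simp: product_sigma_finite_lborel gaussian_def[symmetric] intro: prob_space_imp_sigma_finite\<close>)
  then show ?thesis
    by (simp add: prod_ennreal nonneg prod_gauss_density[OF \<open>finite J\<close>])
qed

subsection \<open>Gram matrices and orthogonal parts\<close>

lemma matrix_mult_add_right: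
  "(B + C) ** A = B ** A + C ** (A :: real^'n^'m)"
  by (simp add: vec_eq_iff matrix_matrix_mult_def sum.distrib distrib_right)

lemma sum_outer_mult_vector:
  fixes A :: "real^'n^'m"
  shows "(\<Sum>j\<in>J. outer (A *v y j)) = A ** (\<Sum>j\<in>J. outer (y j)) ** transpose A"
proof -
  have "outer (A *v v) = A ** outer v ** transpose A" for v
  proof -
    have 1: "(A ** outer v) $ i $ j = (A *v v) $ i * v $ j" for i j
      by (simp add: outer_def matrix_matrix_mult_def matrix_vector_mult_def sum_distrib_right mult.assoc)
    have 2: "(A ** outer v ** transpose A) $ i $ j = (\<Sum>l\<in>UNIV. (A ** outer v) $ i $ l * A $ j $ l)" for i j
      by (simp add: matrix_matrix_mult_def[of "A ** outer v"] transpose_def)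
    have "(A ** outer v ** transpose A) $ i $ j = (A *v v) $ i * (\<Sum>l\<in>UNIV. A $ j $ l * v $ l)" for i j
      by (simp add: 2 1 sum_distrib_left ac_simps)
    then show ?thesis
      by (simp add: vec_eq_iff outer_def matrix_vector_mult_def)
  qed
  then show ?thesis
    by (induction J rule: infinite_finite_induct) (auto simp: matrix_add_ldistrib matrix_mult_add_right)
qed

lemma inner_sum_outer_mult:
  "x \<bullet> ((\<Sum>j\<in>J. outer (y j)) *v x) = (\<Sum>j\<in>J. (x \<bullet> y j)\<^sup>2)"
  by (induction J rule: infinite_finite_induct)
    (auto simp: matrix_vector_mult_add_rdistrib inner_add_right inner_outer_mult)

lemma transpose_sum_outer: "transpose (\<Sum>j\<in>J. outer (y j)) = (\<Sum>j\<in>J. outer (y j))"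
  by (simp add: transpose_def vec_eq_iff outer_def mult.commute)

lemma pos_def_mat_sum_outer_mono:
  assumes "pos_def_mat (\<Sum>j\<in>I. outer (y j))" "I \<subseteq> J" "finite J"
  shows "pos_def_mat (\<Sum>j\<in>J. outer (y j))"
proof -
  have "(\<Sum>j\<in>I. (x \<bullet> y j)\<^sup>2) \<le> (\<Sum>j\<in>J. (x \<bullet> y j)\<^sup>2)" for x
    using assms by (intro sum_mono2) auto
  with assms(1) show ?thesis
    unfolding pos_def_mat_def inner_sum_outer_mult transpose_sum_outer by (meson less_le_trans)
qed

section \<open>Families of vectors as columns of a matrix\<close>

lemma nn_integral_PiM_lborel_columns:
  fixes e :: "'m::finite \<Rightarrow> 'i" and f :: "('i \<Rightarrow> real^'n) \<Rightarrow> ennreal"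
  assumes e: "bij_betw e UNIV I" and f: "f \<in> borel_measurable (PiM I (\<lambda>_. lborel))"
  shows "(\<integral>\<^sup>+x. f x \<partial>PiM I (\<lambda>_. lborel)) = (\<integral>\<^sup>+X. f (\<lambda>i\<in>I. column (inv e i) X) \<partial>lborel)"
proof -
  have [measurable]: "(\<lambda>X::real^'m^'n. \<lambda>i\<in>I. column (inv e i) X) \<in> lborel \<rightarrow>\<^sub>M PiM I (\<lambda>_. lborel)"
    unfolding column_def by measurable
  show ?thesis
    by (subst PiM_lborel_eq_distr_columns[OF e]) (use f in \<open>simp add: nn_integral_distr\<close>)
qed

lemma sum_outer_columns:
  assumes e: "bij_betw e UNIV I"
  shows "(\<Sum>i\<in>I. outer (column (inv e i) X)) = X ** transpose (X :: real^'m^'n)"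
proof -
  have "inj e" using e by (simp add: bij_betw_def)
  then have "(\<Sum>i\<in>I. outer (column (inv e i) X)) = (\<Sum>j\<in>UNIV. outer (column j X))"
    by (simp flip: sum.reindex_bij_betw[OF e])
  then show ?thesis
    by (simp add: vec_eq_iff outer_def column_def matrix_matrix_mult_def transpose_def)
qed

text \<open>For \<open>CARD('n)\<close> of the vectors the Gram matrix is \<open>X X^T\<close> with
  \<open>X\<close> square, and almost every \<open>X\<close> is nonsingular. The remaining vectors
  only add positive semidefinite terms.\<close>

lemma AE_PiM_lborel_pos_def:
  fixes J :: "'i set"
  assumes J: "finite J" "CARD('n) \<le> card J"
  shows "AE y in PiM J (\<lambda>_. lborel :: (real^'n) measure). pos_def_mat (\<Sum>j\<in>J. outer (y j))"
proof -
  obtain I where I: "I \<subseteq> J" "card I = CARD('n)" "finite I"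
    using obtain_subset_with_card_n[OF J(2)] by metis
  obtain e :: "'n \<Rightarrow> 'i" where e: "bij_betw e UNIV I"
    using finite_same_card_bij[of "UNIV :: 'n set" I] I by auto
  let ?L = "\<lambda>I::'i set. PiM I (\<lambda>_. lborel :: (real^'n) measure)"
  let ?N = "\<lambda>y. if pos_def_mat (\<Sum>i\<in>I. outer (y i :: real^'n)) then 0 else 1 :: ennreal"
  have [measurable]: "(\<lambda>y. y i) \<in> borel_measurable (?L K)" if "i \<in> K" for i K
    using measurable_component_singleton[OF that, of "\<lambda>_. lborel :: (real^'n) measure"] by simp
  have N [measurable]: "?N \<in> borel_measurable (?L K)" if "I \<subseteq> K" for K
    using that by (measurable; auto)
  have "(\<integral>\<^sup>+x. ?N x \<partial>?L I) = (\<integral>\<^sup>+X. (if pos_def_mat (X ** transpose X) then 0 else 1) \<partial>(lborel :: (real^'n^'n) measure))"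
    by (subst nn_integral_PiM_lborel_columns[OF e]) (auto simp: N sum_outer_columns[OF e] cong: sum.cong)
  also have "\<dots> = (\<integral>\<^sup>+X. 0 \<partial>(lborel :: (real^'n^'n) measure))"
    by (intro nn_integral_cong_AE) (use AE_lborel_det_nz in \<open>eventually_elim, simp add: pos_def_mat_mult_transpose\<close>)
  finally have I0: "(\<integral>\<^sup>+x. ?N x \<partial>?L I) = 0" by simp
  \<comment> \<open>The failure indicator \<open>?N\<close> looks at the coordinates in
    \<open>I\<close> only. Its integral over these is 0, and 0 times the possibly infinite mass of
    the other coordinates is 0.\<close>
  have IJ: "I \<union> (J - I) = J" using I by auto
  have "(\<integral>\<^sup>+y. ?N y \<partial>?L J) = (\<integral>\<^sup>+x. (\<integral>\<^sup>+z. ?N (merge I (J - I) (x, z)) \<partial>?L (J - I)) \<partial>?L I)"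
    using lborel_product.product_nn_integral_fold[of I "J - I" ?N] N[of J] I J unfolding IJ by auto
  also have "\<dots> = (\<integral>\<^sup>+x. (\<integral>\<^sup>+z. ?N x \<partial>?L (J - I)) \<partial>?L I)"
    by (intro nn_integral_cong) (simp cong: sum.cong)
  also have "\<dots> = (\<integral>\<^sup>+x. ?N x * emeasure (?L (J - I)) (space (?L (J - I))) \<partial>?L I)"
    by (simp only: nn_integral_const)
  also have "\<dots> = 0"
    by (subst nn_integral_multc) (auto simp: N I0)
  finally have "AE y in ?L J. ?N y = 0"
    by (subst (asm) nn_integral_0_iff_AE) (use I in \<open>auto simp: N\<close>)
  then show ?thesis
    by eventually_elim (use I J in \<open>auto intro: pos_def_mat_sum_outer_mono split: if_splits\<close>)
qed

text \<open>The orthogonal factor in the decomposition \<open>X = L Q\<close> with \<open>L\<close>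
  lower triangular. For singular \<open>X\<close> the factor \<open>chol_inv\<close> is 0, and so is
  \<open>orth_part X\<close>.\<close>

definition orth_part :: "'n::{finite,linorder} sqmat \<Rightarrow> 'n::{finite,linorder} sqmat" where
  "orth_part X = chol_inv (X ** transpose X) ** X"

lemma borel_measurable_orth_part [measurable (raw)]:
  fixes f :: "'a \<Rightarrow> 'n::{finite,linorder} sqmat"
  assumes [measurable]: "f \<in> borel_measurable M"
  shows "(\<lambda>x. orth_part (f x)) \<in> borel_measurable M"
  unfolding orth_part_def by measurable

lemma mult_transpose_orthogonal:
  fixes X :: "real^'n^'m"
  assumes "orthogonal_matrix U"
  shows "(X ** U) ** transpose (X ** U) = X ** transpose X"
proof -
  have "U ** transpose U = mat 1" using assms by (simp add: orthogonal_matrix_def)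
  then show ?thesis by (metis matrix_mul_assoc matrix_mul_rid matrix_transpose_mul)
qed

lemma orth_part_mult_orthogonal: "orthogonal_matrix U \<Longrightarrow> orth_part (X ** U) = orth_part X ** U"
  by (simp add: orth_part_def mult_transpose_orthogonal matrix_mul_assoc)

lemma
  assumes "det X \<noteq> 0"
  shows chol_mult_orth_part: "chol (X ** transpose X) ** orth_part X = X"
    and orthogonal_orth_part: "orthogonal_matrix (orth_part X)"
proof -
  let ?W = "X ** transpose X"
  note pd = pos_def_mat_mult_transpose[OF assms]
  show "chol ?W ** orth_part X = X"
    by (simp add: orth_part_def matrix_mul_assoc chol_inv_mult[OF pd])
  have "orth_part X ** transpose (orth_part X) = chol_inv ?W ** ?W ** transpose (chol_inv ?W)"
    by (simp add: orth_part_def matrix_transpose_mul matrix_mul_assoc)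
  also have "\<dots> = (chol_inv ?W ** chol ?W) ** (transpose (chol ?W) ** transpose (chol_inv ?W))"
    by (metis chol_mult_transpose[OF pd] matrix_mul_assoc)
  also have "\<dots> = mat 1"
    by (simp add: chol_inv_mult[OF pd] transpose_mat flip: matrix_transpose_mul)
  finally show "orthogonal_matrix (orth_part X)"
    unfolding orthogonal_matrix_def using matrix_left_right_inverse by blast
qed

lemma orth_part_chol_mult:
  assumes W: "pos_def_mat W" and U: "orthogonal_matrix U"
  shows "orth_part (chol W ** U) = U"
proof -
  have "(chol W ** U) ** transpose (chol W ** U) = W"
    by (simp add: mult_transpose_orthogonal[OF U] chol_mult_transpose[OF W])
  then show ?thesis
    by (simp add: orth_part_def matrix_mul_assoc chol_inv_mult[OF W])
qed

lemma nn_integral_lborel_orthogonal: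
  fixes f :: "real^'n^'n \<Rightarrow> ennreal"
  assumes "orthogonal_matrix U" "f \<in> borel_measurable borel"
  shows "(\<integral>\<^sup>+X. f (X ** U) \<partial>lborel) = (\<integral>\<^sup>+X. f X \<partial>lborel)"
  using nn_integral_lborel_matrix_right[of U f] det_orthogonal_matrix[OF assms(1)] assms(2) by auto

text \<open>Under an orthogonally invariant law the Cholesky factor and the orthogonal part are independent,
  and the latter has the same law as its transpose. Both follow by inserting an independent copy
  \<open>Y\<close> and rotating \<open>X\<close> by the orthogonal part of \<open>Y\<close> and then \<open>Y\<close> by that of \<open>X\<close>, so that no Haar
  measure on the orthogonal group is needed.\<close>
lemma nn_integral_orth_part_independent:
  fixes h g F :: "'n::{finite,linorder} sqmat \<Rightarrow> ennreal"
  assumes [measurable]: "h \<in> borel_measurable borel" "g \<in> borel_measurable borel" "F \<in> borel_measurable borel"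
    and F: "(\<integral>\<^sup>+X. F (X ** transpose X) \<partial>(lborel :: 'n sqmat measure)) = 1"
  shows "(\<integral>\<^sup>+X. h X * g (X ** transpose X) \<partial>(lborel :: 'n sqmat measure)) = (\<integral>\<^sup>+X. g (X ** transpose X) *
     (\<integral>\<^sup>+Y. h (chol (X ** transpose X) ** transpose (orth_part Y)) * F (Y ** transpose Y) \<partial>(lborel :: 'n sqmat measure)) \<partial>(lborel :: 'n sqmat measure))"
proof -
  have "(\<integral>\<^sup>+X. h X * g (X ** transpose X) \<partial>(lborel :: 'n sqmat measure))
      = (\<integral>\<^sup>+Y. F (Y ** transpose Y) * (\<integral>\<^sup>+X. h X * g (X ** transpose X) \<partial>(lborel :: 'n sqmat measure)) \<partial>(lborel :: 'n sqmat measure))"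
    by (subst nn_integral_multc) (auto simp: F)
  also have "\<dots> = (\<integral>\<^sup>+Y. F (Y ** transpose Y) *
      (\<integral>\<^sup>+X. h (X ** transpose (orth_part Y)) * g (X ** transpose X) \<partial>(lborel :: 'n sqmat measure)) \<partial>(lborel :: 'n sqmat measure))"
  proof (intro nn_integral_cong_AE)
    show "AE Y in (lborel :: 'n sqmat measure). F (Y ** transpose Y) * (\<integral>\<^sup>+X. h X * g (X ** transpose X) \<partial>(lborel :: 'n sqmat measure)) =
        F (Y ** transpose Y) * (\<integral>\<^sup>+X. h (X ** transpose (orth_part Y)) * g (X ** transpose X) \<partial>(lborel :: 'n sqmat measure))"
      using AE_lborel_det_nz
    proof eventually_elim
      fix Y :: "'n::{finite,linorder} sqmat" assume "det Y \<noteq> 0"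
      then have U: "orthogonal_matrix (transpose (orth_part Y))"
        by (simp add: orthogonal_orth_part orthogonal_matrix_transpose)
      show "F (Y ** transpose Y) * (\<integral>\<^sup>+X. h X * g (X ** transpose X) \<partial>(lborel :: 'n sqmat measure)) =
        F (Y ** transpose Y) * (\<integral>\<^sup>+X. h (X ** transpose (orth_part Y)) * g (X ** transpose X) \<partial>(lborel :: 'n sqmat measure))"
        using nn_integral_lborel_orthogonal[OF U, of "\<lambda>X. h X * g (X ** transpose X)"]
        by (simp add: mult_transpose_orthogonal[OF U])
    qed
  qed
  also have "\<dots> = (\<integral>\<^sup>+Y. (\<integral>\<^sup>+X. F (Y ** transpose Y) *
      (h (X ** transpose (orth_part Y)) * g (X ** transpose X)) \<partial>(lborel :: 'n sqmat measure)) \<partial>(lborel :: 'n sqmat measure))"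
    by (subst nn_integral_cmult) auto
  also have "\<dots> = (\<integral>\<^sup>+X. (\<integral>\<^sup>+Y. F (Y ** transpose Y) *
      (h (X ** transpose (orth_part Y)) * g (X ** transpose X)) \<partial>(lborel :: 'n sqmat measure)) \<partial>(lborel :: 'n sqmat measure))"
    by (rule lborel_pair.Fubini') measurable
  also have "\<dots> = (\<integral>\<^sup>+X. g (X ** transpose X) *
      (\<integral>\<^sup>+Y. h (X ** transpose (orth_part Y)) * F (Y ** transpose Y) \<partial>(lborel :: 'n sqmat measure)) \<partial>(lborel :: 'n sqmat measure))"
    by (subst nn_integral_cmult[symmetric]) (auto simp: ac_simps)
  also have "\<dots> = (\<integral>\<^sup>+X. g (X ** transpose X) *
     (\<integral>\<^sup>+Y. h (chol (X ** transpose X) ** transpose (orth_part Y)) * F (Y ** transpose Y) \<partial>(lborel :: 'n sqmat measure)) \<partial>(lborel :: 'n sqmat measure))"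
  proof (intro nn_integral_cong_AE)
    show "AE X in (lborel :: 'n sqmat measure). g (X ** transpose X) *
      (\<integral>\<^sup>+Y. h (X ** transpose (orth_part Y)) * F (Y ** transpose Y) \<partial>(lborel :: 'n sqmat measure)) = g (X ** transpose X) *
     (\<integral>\<^sup>+Y. h (chol (X ** transpose X) ** transpose (orth_part Y)) * F (Y ** transpose Y) \<partial>(lborel :: 'n sqmat measure))"
      using AE_lborel_det_nz
    proof eventually_elim
      fix X :: "'n::{finite,linorder} sqmat" assume X: "det X \<noteq> 0"
      note U = orthogonal_orth_part[OF X]
      \<comment> \<open>Under the substitution of \<open>Y ** orth_part X\<close> for
        \<open>Y\<close> the orthogonal part of \<open>X\<close> cancels:
        \<open>X ** transpose (orth_part X)\<close> is the Cholesky factor of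
        \<open>X X^T\<close>.\<close>
      have "X ** transpose (orth_part Y ** orth_part X) = chol (X ** transpose X) ** transpose (orth_part Y)" for Y
      proof -
        have "X ** transpose (orth_part X) = chol (X ** transpose X)"
          using chol_mult_orth_part[OF X] U
          by (metis matrix_mul_assoc matrix_mul_rid orthogonal_matrix_def)
        then show ?thesis by (simp add: matrix_transpose_mul matrix_mul_assoc)
      qed
      then show "g (X ** transpose X) *
      (\<integral>\<^sup>+Y. h (X ** transpose (orth_part Y)) * F (Y ** transpose Y) \<partial>(lborel :: 'n sqmat measure)) = g (X ** transpose X) *
     (\<integral>\<^sup>+Y. h (chol (X ** transpose X) ** transpose (orth_part Y)) * F (Y ** transpose Y) \<partial>(lborel :: 'n sqmat measure))"
        using nn_integral_lborel_orthogonal[OF U, of "\<lambda>Y. h (X ** transpose (orth_part Y)) * F (Y ** transpose Y)"]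
        by (simp add: orth_part_mult_orthogonal[OF U] mult_transpose_orthogonal[OF U])
    qed
  qed
  finally show ?thesis .
qed

text \<open>Independence is applied to \<open>h (orth_part X)\<close>: its right-hand side contains
  the orthogonal part of \<open>chol (X X^T) ** transpose (orth_part Y)\<close>, which is
  \<open>transpose (orth_part Y)\<close> by \<open>orth_part_chol_mult\<close>. The inner integral
  no longer depends on \<open>X\<close>, and \<open>F\<close> integrates to 1.\<close>

lemma nn_integral_orth_part_transpose:
  fixes h F :: "'n::{finite,linorder} sqmat \<Rightarrow> ennreal"
  assumes [measurable]: "h \<in> borel_measurable borel" "F \<in> borel_measurable borel"
    and F: "(\<integral>\<^sup>+X. F (X ** transpose X) \<partial>(lborel :: 'n sqmat measure)) = 1"
  shows "(\<integral>\<^sup>+X. h (orth_part X) * F (X ** transpose X) \<partial>(lborel :: 'n sqmat measure))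
     = (\<integral>\<^sup>+X. h (transpose (orth_part X)) * F (X ** transpose X) \<partial>(lborel :: 'n sqmat measure))"
proof -
  let ?r = "\<integral>\<^sup>+Y. h (transpose (orth_part Y)) * F (Y ** transpose Y) \<partial>(lborel :: 'n sqmat measure)"
  have "(\<integral>\<^sup>+X. h (orth_part X) * F (X ** transpose X) \<partial>(lborel :: 'n sqmat measure)) = (\<integral>\<^sup>+X. F (X ** transpose X) *
     (\<integral>\<^sup>+Y. h (orth_part (chol (X ** transpose X) ** transpose (orth_part Y))) * F (Y ** transpose Y) \<partial>(lborel :: 'n sqmat measure)) \<partial>(lborel :: 'n sqmat measure))"
    by (rule nn_integral_orth_part_independent[OF _ _ _ F]) measurable
  also have "\<dots> = (\<integral>\<^sup>+X. F (X ** transpose X) * ?r \<partial>(lborel :: 'n sqmat measure))"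
  proof (intro nn_integral_cong_AE)
    show "AE X in (lborel :: 'n sqmat measure). F (X ** transpose X) *
     (\<integral>\<^sup>+Y. h (orth_part (chol (X ** transpose X) ** transpose (orth_part Y))) * F (Y ** transpose Y) \<partial>(lborel :: 'n sqmat measure))
      = F (X ** transpose X) * ?r"
      using AE_lborel_det_nz
    proof eventually_elim
      fix X :: "'n::{finite,linorder} sqmat" assume X: "det X \<noteq> 0"
      have "(\<integral>\<^sup>+Y. h (orth_part (chol (X ** transpose X) ** transpose (orth_part Y))) * F (Y ** transpose Y) \<partial>(lborel :: 'n sqmat measure)) = ?r"
        by (intro nn_integral_cong_AE, use AE_lborel_det_nz in eventually_elim)
          (simp add: orth_part_chol_mult pos_def_mat_mult_transpose X orthogonal_orth_part orthogonal_matrix_transpose)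
      then show "F (X ** transpose X) *
     (\<integral>\<^sup>+Y. h (orth_part (chol (X ** transpose X) ** transpose (orth_part Y))) * F (Y ** transpose Y) \<partial>(lborel :: 'n sqmat measure))
      = F (X ** transpose X) * ?r" by simp
    qed
  qed
  also have "\<dots> = ?r"
    by (subst nn_integral_multc) (auto simp: F)
  finally show ?thesis .
qed

subsection \<open>Invariant measures on positive definite matrices\<close>

lemma det_matrix_inv:
  fixes A :: "real^'n^'n"
  assumes "det A \<noteq> 0"
  shows "det (matrix_inv A) = 1 / det A"
proof -
  have "det A * det (matrix_inv A) = 1"
    using matrix_inv_mult(1)[OF assms] by (metis det_I det_mul)
  then show ?thesis using assms by (simp add: field_simps)
qed

text \<open>The inverse of the triple product splits into three inverses, and the outer two cancel
  against \<open>transpose X\<close> and \<open>X\<close>. This is what frees the kernel of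
  \<open>nn_integral_gram_eq\<close> from \<open>X\<close>.\<close>

lemma matrix_inv_mult3:
  fixes X W :: "real^'n^'n"
  assumes X: "det X \<noteq> 0" and W: "det W \<noteq> 0"
  shows "transpose X ** matrix_inv (X ** W ** transpose X) ** X = matrix_inv W"
proof (rule matrix_inv_unique[symmetric])
  let ?V = "X ** W ** transpose X"
  have V: "det ?V \<noteq> 0" using assms by (simp add: det_mul)
  have "X ** (W ** (transpose X ** matrix_inv ?V ** X)) = (?V ** matrix_inv ?V) ** X"
    by (simp add: matrix_mul_assoc)
  also have "\<dots> = X ** mat 1" by (simp add: matrix_inv_mult[OF V])
  finally have "matrix_inv X ** X ** (W ** (transpose X ** matrix_inv ?V ** X)) = matrix_inv X ** X ** mat 1"
    by (metis matrix_mul_assoc)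
  then show "W ** (transpose X ** matrix_inv ?V ** X) = mat 1"
    by (simp add: matrix_inv_mult[OF X])
qed

text \<open>Uniqueness, up to a factor, of the measure on positive definite matrices that is invariant
  under congruence. The kernel \<open>F (X\<^sup>T W\<^sup>-\<^sup>1 X)\<close> links the Gram matrix \<open>W\<close> of the \<open>y j\<close> to
  \<open>X X\<^sup>T\<close>: the substitution \<open>y \<rightarrow> X y\<close> turns it into \<open>F (W\<^sup>-\<^sup>1)\<close>, and \<open>X \<rightarrow> X (chol W)\<^sup>-\<^sup>1\<close> then
  separates the two integrals.\<close>
lemma nn_integral_gram_eq:
  fixes J :: "'i set" and F :: "'n::{finite,linorder} sqmat \<Rightarrow> ennreal"
  assumes J: "finite J" "CARD('n) \<le> card J"
    and [measurable]: "F \<in> borel_measurable borel"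
    and F: "(\<integral>\<^sup>+X. F (X ** transpose X) \<partial>(lborel :: 'n sqmat measure)) = 1"
  shows "\<exists>K. \<forall>\<theta>\<in>borel_measurable borel.
     (\<integral>\<^sup>+y. \<theta> (\<Sum>j\<in>J. outer (y j)) \<partial>PiM J (\<lambda>_. lborel)) =
     K * (\<integral>\<^sup>+X. ennreal (\<bar>det X\<bar> ^ (card J - CARD('n))) * \<theta> (X ** transpose X) \<partial>(lborel :: 'n sqmat measure))"
proof (intro exI ballI)
  let ?L = "PiM J (\<lambda>_. lborel :: (real, 'n) vec measure)"
  let ?M = "lborel :: 'n sqmat measure"
  let ?d = "CARD('n)" and ?n = "card J"
  let ?W = "\<lambda>y. \<Sum>j\<in>J. outer (y j :: (real, 'n) vec)"
  let ?r = "\<lambda>W::'n sqmat. ennreal ((1 / sqrt (det W)) ^ ?d)"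
  \<comment> \<open>The constant does not depend on \<theta>; in \<open>theorem4\<close> the total
    mass of a probability measure identifies it.\<close>
  let ?K = "\<integral>\<^sup>+y. ?r (?W y) * F (matrix_inv (?W y)) * ennreal ((1 / sqrt (det (?W y))) ^ ?n) \<partial>?L"
  fix \<theta> :: "'n sqmat \<Rightarrow> ennreal" assume [measurable]: "\<theta> \<in> borel_measurable borel"
  let ?V = "\<integral>\<^sup>+X. ennreal (\<bar>det X\<bar> ^ (?n - ?d)) * \<theta> (X ** transpose X) \<partial>?M"
  interpret LJ: finite_product_sigma_finite "\<lambda>_. lborel :: (real, 'n) vec measure" J
    by standard (rule J(1))
  interpret pair: pair_sigma_finite ?L ?M
    by (intro pair_sigma_finite.intro LJ.sigma_finite_measure_axioms lborel.sigma_finite_measure_axioms)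
  interpret rev: pair_sigma_finite ?M ?L
    by (intro pair_sigma_finite.intro LJ.sigma_finite_measure_axioms lborel.sigma_finite_measure_axioms)
  have [measurable]: "(\<lambda>y. y i) \<in> borel_measurable ?L" if "i \<in> J" for i
    using measurable_component_singleton[OF that, of "\<lambda>_. lborel :: (real, 'n) vec measure"] by simp
  have W [measurable]: "?W \<in> borel_measurable ?L" by measurable
  have pd: "AE y in ?L. pos_def_mat (?W y)" by (rule AE_PiM_lborel_pos_def[OF J])
  have Ft: "(\<integral>\<^sup>+X. F (transpose X ** X) \<partial>?M) = 1"
    using nn_integral_lborel_transpose[of "\<lambda>X::'n sqmat. F (X ** transpose X)"] F by simp
  have chol: "\<bar>det (chol_inv W)\<bar> = 1 / sqrt (det W)" "det (chol_inv W) \<noteq> 0"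
    "transpose (chol_inv W) ** chol_inv W = matrix_inv W" "chol_inv W ** W ** transpose (chol_inv W) = mat 1"
    if "pos_def_mat W" for W :: "'n sqmat"
  proof -
    note nz = det_chol_nz[OF that]
    have "sqrt (det W) = \<bar>det (chol W)\<bar>"
      using det_chol_squared[OF that] by (metis real_sqrt_abs)
    then show "\<bar>det (chol_inv W)\<bar> = 1 / sqrt (det W)" "det (chol_inv W) \<noteq> 0"
      using that nz by (simp_all add: chol_inv_def det_matrix_inv)
    show "transpose (chol_inv W) ** chol_inv W = matrix_inv W"
      using matrix_inv_mult_transpose[OF nz] that by (simp add: chol_inv_def chol_mult_transpose)
    have "chol_inv W ** W ** transpose (chol_inv W)
        = (chol_inv W ** chol W) ** (transpose (chol W) ** transpose (chol_inv W))"
      by (metis chol_mult_transpose[OF that] matrix_mul_assoc)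
    then show "chol_inv W ** W ** transpose (chol_inv W) = mat 1"
      by (simp add: chol_inv_mult[OF that] transpose_mat flip: matrix_transpose_mul)
  qed
  \<comment> \<open>\<open>?r W\<close> is the Jacobian of \<open>X -> chol_inv W ** X\<close>, so
    \<open>?r W\<close> times the kernel has integral 1 over \<open>X\<close> and can be inserted
    under the integral.\<close>
  have kernel: "?r W * (\<integral>\<^sup>+X. F (transpose X ** matrix_inv W ** X) \<partial>?M) = 1" if W: "pos_def_mat W" for W
    using nn_integral_lborel_matrix_left[OF chol(2)[OF W], of "\<lambda>X. F (transpose X ** X)"] Ft
    by (simp add: chol(1)[OF W] matrix_transpose_mul matrix_mul_assoc chol(3)[OF W, symmetric])
  have "(\<integral>\<^sup>+y. \<theta> (?W y) \<partial>?L)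
      = (\<integral>\<^sup>+y. (\<integral>\<^sup>+X. \<theta> (?W y) * ?r (?W y) * F (transpose X ** matrix_inv (?W y) ** X) \<partial>?M) \<partial>?L)"
    by (intro nn_integral_cong_AE, use pd in eventually_elim)
      (subst nn_integral_cmult, auto simp: kernel mult.assoc)
  also have "\<dots> = (\<integral>\<^sup>+X. (\<integral>\<^sup>+y. \<theta> (?W y) * ?r (?W y) * F (transpose X ** matrix_inv (?W y) ** X) \<partial>?L) \<partial>?M)"
    by (rule rev.Fubini') measurable
  also have "\<dots> = (\<integral>\<^sup>+X. (\<integral>\<^sup>+y. ennreal (\<bar>det X\<bar> ^ (?n - ?d)) * \<theta> (X ** ?W y ** transpose X) *
      (?r (?W y) * F (matrix_inv (?W y))) \<partial>?L) \<partial>?M)"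
  proof (intro nn_integral_cong_AE, use AE_lborel_det_nz in eventually_elim)
    fix X :: "'n sqmat" assume X: "det X \<noteq> 0"
    let ?G = "\<lambda>y. \<theta> (?W y) * ?r (?W y) * F (transpose X ** matrix_inv (?W y) ** X)"
    have "(\<integral>\<^sup>+y. ?G y \<partial>?L) = ennreal (\<bar>det X\<bar> ^ ?n) * (\<integral>\<^sup>+y. ?G (\<lambda>j\<in>J. X *v y j) \<partial>?L)"
      by (rule nn_integral_PiM_lborel_matrix_vector[OF J(1) X, symmetric]) measurable
    also have "\<dots> = (\<integral>\<^sup>+y. ennreal (\<bar>det X\<bar> ^ ?n) * ?G (\<lambda>j\<in>J. X *v y j) \<partial>?L)"
      by (subst nn_integral_cmult) auto
    also have "\<dots> = (\<integral>\<^sup>+y. ennreal (\<bar>det X\<bar> ^ (?n - ?d)) * \<theta> (X ** ?W y ** transpose X) *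
      (?r (?W y) * F (matrix_inv (?W y))) \<partial>?L)"
    proof (intro nn_integral_cong_AE, use pd in eventually_elim)
      fix y assume y: "pos_def_mat (?W y)"
      have Wy: "?W (\<lambda>j\<in>J. X *v y j) = X ** ?W y ** transpose X"
        by (simp add: sum_outer_mult_vector[symmetric] cong: sum.cong)
      \<comment> \<open>The Jacobian contributes \<open>?n\<close> powers of \<bar>det X\<bar> and
        \<open>?r\<close> takes away \<open>?d\<close> of them. The natural-number difference is the
        true one because \<open>CARD('n) \<le> card J\<close>.\<close>
      have "ennreal (\<bar>det X\<bar> ^ ?n) * ?r (X ** ?W y ** transpose X) = ennreal (\<bar>det X\<bar> ^ (?n - ?d)) * ?r (?W y)"
      proof -
        have "sqrt (det (X ** ?W y ** transpose X)) = \<bar>det X\<bar> * sqrt (det (?W y))"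
          by (simp add: det_mul real_sqrt_mult)
        then have "\<bar>det X\<bar> ^ ?n * (1 / sqrt (det (X ** ?W y ** transpose X))) ^ ?d
            = \<bar>det X\<bar> ^ ?n / \<bar>det X\<bar> ^ ?d * (1 / sqrt (det (?W y))) ^ ?d"
          by (simp add: power_mult_distrib power_divide)
        also have "\<bar>det X\<bar> ^ ?n / \<bar>det X\<bar> ^ ?d = \<bar>det X\<bar> ^ (?n - ?d)"
          using X J by (simp add: power_diff)
        finally show ?thesis by (simp flip: ennreal_mult')
      qed
      moreover have "a * (t * r * f) = b * t * (s * f)" if "a * r = b * s" for a b r s t f :: ennreal
        using that by (metis mult.assoc mult.commute)
      ultimately show "ennreal (\<bar>det X\<bar> ^ ?n) * ?G (\<lambda>j\<in>J. X *v y j) = ennreal (\<bar>det X\<bar> ^ (?n - ?d)) *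
          \<theta> (X ** ?W y ** transpose X) * (?r (?W y) * F (matrix_inv (?W y)))"
        unfolding Wy matrix_inv_mult3[OF X pos_def_mat_det_nz[OF y]] by blast
    qed
    finally show "(\<integral>\<^sup>+y. ?G y \<partial>?L) = (\<integral>\<^sup>+y. ennreal (\<bar>det X\<bar> ^ (?n - ?d)) * \<theta> (X ** ?W y ** transpose X) *
      (?r (?W y) * F (matrix_inv (?W y))) \<partial>?L)" .
  qed
  also have "\<dots> = (\<integral>\<^sup>+y. (\<integral>\<^sup>+X. ennreal (\<bar>det X\<bar> ^ (?n - ?d)) * \<theta> (X ** ?W y ** transpose X) *
      (?r (?W y) * F (matrix_inv (?W y))) \<partial>?M) \<partial>?L)"
    by (rule pair.Fubini') measurable
  also have "\<dots> = (\<integral>\<^sup>+y. ?r (?W y) * F (matrix_inv (?W y)) * ennreal ((1 / sqrt (det (?W y))) ^ ?n) * ?V \<partial>?L)"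
  proof (intro nn_integral_cong_AE, use pd in eventually_elim)
    fix y assume y: "pos_def_mat (?W y)"
    let ?C = "chol_inv (?W y)"
    let ?H = "\<lambda>X. ennreal (\<bar>det X\<bar> ^ (?n - ?d)) * \<theta> (X ** ?W y ** transpose X)"
    have "(X ** ?C) ** ?W y ** transpose (X ** ?C) = X ** (?C ** ?W y ** transpose ?C) ** transpose X" for X :: "'n sqmat"
      by (simp add: matrix_transpose_mul matrix_mul_assoc)
    then have XC: "(X ** ?C) ** ?W y ** transpose (X ** ?C) = X ** transpose X" for X :: "'n sqmat"
      by (simp add: chol(4)[OF y])
    have "(\<integral>\<^sup>+X. ?H X \<partial>?M) = ennreal (\<bar>det ?C\<bar> ^ ?d) * (\<integral>\<^sup>+X. ?H (X ** ?C) \<partial>?M)"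
      by (rule nn_integral_lborel_matrix_right[OF chol(2)[OF y], symmetric]) measurable
    also have "\<dots> = ennreal (\<bar>det ?C\<bar> ^ ?d) * (\<integral>\<^sup>+X. ennreal (\<bar>det ?C\<bar> ^ (?n - ?d)) *
        (ennreal (\<bar>det X\<bar> ^ (?n - ?d)) * \<theta> (X ** transpose X)) \<partial>?M)"
      unfolding XC by (simp add: det_mul abs_mult power_mult_distrib ennreal_mult ac_simps)
    also have "\<dots> = ennreal (\<bar>det ?C\<bar> ^ ?d) * ennreal (\<bar>det ?C\<bar> ^ (?n - ?d)) * ?V"
      by (subst nn_integral_cmult) (auto simp: mult.assoc)
    also have "ennreal (\<bar>det ?C\<bar> ^ ?d) * ennreal (\<bar>det ?C\<bar> ^ (?n - ?d)) = ennreal (\<bar>det ?C\<bar> ^ ?n)"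
      using J by (simp flip: ennreal_mult power_add)
    finally have "(\<integral>\<^sup>+X. ?H X \<partial>?M) = ennreal ((1 / sqrt (det (?W y))) ^ ?n) * ?V"
      by (simp add: chol(1)[OF y])
    moreover have "(\<integral>\<^sup>+X. ?H X * (?r (?W y) * F (matrix_inv (?W y))) \<partial>?M)
        = (\<integral>\<^sup>+X. ?H X \<partial>?M) * (?r (?W y) * F (matrix_inv (?W y)))"
      by (rule nn_integral_multc) measurable
    ultimately show "(\<integral>\<^sup>+X. ?H X * (?r (?W y) * F (matrix_inv (?W y))) \<partial>?M) =
        ?r (?W y) * F (matrix_inv (?W y)) * ennreal ((1 / sqrt (det (?W y))) ^ ?n) * ?V"
      by (simp add: ac_simps)
  qed
  also have "\<dots> = ?K * ?V"
    by (rule nn_integral_multc) measurable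
  finally show "(\<integral>\<^sup>+y. \<theta> (?W y) \<partial>?L) = ?K * ?V" .
qed

subsection \<open>Volume sampling\<close>

lemma column_matrix_mult: "column j (A ** X) = A *v column j (X :: real^'n^'m)"
  by (simp add: vec_eq_iff column_def matrix_vector_mult_def matrix_matrix_mult_def)

text \<open>With the vectors as columns of \<open>X\<close>, their joint density is a function of
  \<open>X X^T\<close> alone, hence unchanged by right multiplication with an orthogonal matrix. In
  this form the independence lemmas apply to the sample.\<close>

lemma nn_integral_PiM_gaussian_columns:
  fixes S :: "'d::{finite,linorder} sqmat" and e :: "'d \<Rightarrow> 'i"
  assumes S: "pos_def_mat S" and e: "bij_betw e UNIV I"
    and f: "f \<in> borel_measurable (PiM I (\<lambda>_. borel))"
  shows "(\<integral>\<^sup>+x. f x \<partial>PiM I (\<lambda>_. gaussian S)) = (\<integral>\<^sup>+X. f (\<lambda>i\<in>I. column (inv e i) X) *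
     ennreal (gauss_weight S CARD('d) (X ** transpose X)) \<partial>(lborel :: 'd sqmat measure))"
proof -
  have I: "finite I" "card I = CARD('d)"
    using e bij_betw_same_card[OF e] by (auto simp: bij_betw_def)
  have [measurable]: "(\<lambda>y. y i) \<in> borel_measurable (PiM I (\<lambda>_. lborel :: (real, 'd) vec measure))" if "i \<in> I" for i
    using measurable_component_singleton[OF that, of "\<lambda>_. lborel :: (real, 'd) vec measure"] by simp
  have "sets (PiM I (\<lambda>_. lborel :: (real, 'd) vec measure)) = sets (PiM I (\<lambda>_. borel))"
    by (intro sets_PiM_cong) auto
  then have [measurable]: "f \<in> borel_measurable (PiM I (\<lambda>_. lborel))"
    using f measurable_cong_sets by blast
  have "(\<integral>\<^sup>+x. f x \<partial>PiM I (\<lambda>_. gaussian S))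
      = (\<integral>\<^sup>+x. ennreal (gauss_weight S (card I) (\<Sum>i\<in>I. outer (x i))) * f x \<partial>PiM I (\<lambda>_. lborel))"
    unfolding PiM_gaussian[OF S I(1)] by (rule nn_integral_density) measurable
  also have "\<dots> = (\<integral>\<^sup>+X. f (\<lambda>i\<in>I. column (inv e i) X) *
     ennreal (gauss_weight S CARD('d) (X ** transpose X)) \<partial>(lborel :: 'd sqmat measure))"
    by (subst nn_integral_PiM_lborel_columns[OF e])
      (auto simp: I sum_outer_columns[OF e] mult.commute cong: sum.cong)
  finally show ?thesis .
qed

theorem theorem4:
  fixes S :: "real^'d::{finite,linorder}^'d::{finite,linorder}"
  assumes "pos_def_mat S"
  shows "distr (PiM {..<2 * CARD('d) + 2} (\<lambda>_. gaussian S))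
                (PiM {..<CARD('d)} (\<lambda>_. borel))
                (\<lambda>x. \<lambda>i\<in>{..<CARD('d)}.
                   (chol (\<Sum>j\<in>{CARD('d)..<2 * CARD('d) + 2}. outer (x j))
                    ** chol_inv (\<Sum>j<CARD('d). outer (x j))) *v x i)
         = VS (gaussian S) S"
proof -
  note S = assms
  \<comment> \<open>\<open>I\<close> holds the \<open>d\<close> vectors to be transformed and
    \<open>J\<close> the \<open>d + 2\<close> vectors that supply the new Gram matrix; counting
    starts at 0.\<close>
  define I J where "I = {..<CARD('d)}" and "J = {CARD('d)..<2 * CARD('d) + 2}"
  have IJ: "{..<2 * CARD('d) + 2} = I \<union> J" "I \<inter> J = {}" "finite I" "finite J" and card: "card I = CARD('d)" "card J = CARD('d) + 2"
    by (auto simp: I_def J_def)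
  obtain e :: "'d \<Rightarrow> nat" where e: "bij_betw e UNIV I"
    using finite_same_card_bij[of "UNIV :: 'd set" I] IJ card by auto
  let ?M = "lborel :: 'd sqmat measure"
  let ?B = "\<lambda>I::nat set. PiM I (\<lambda>_. borel :: (real, 'd) vec measure)"
  let ?N = "\<lambda>I::nat set. PiM I (\<lambda>_. gaussian S)"
  let ?W = "\<lambda>I x. \<Sum>i\<in>I. outer (x i :: (real, 'd) vec)"
  let ?T = "\<lambda>x. \<lambda>i\<in>I. (chol (?W J x) ** chol_inv (?W I x)) *v x i"
  let ?G = "\<lambda>w. ennreal (gauss_weight S CARD('d) w)"
  let ?cols = "\<lambda>X. \<lambda>i\<in>I. column (inv e i) (X :: 'd sqmat)"
  define c where "c = fact CARD('d) * det S"
  have c: "c > 0" using pos_def_mat_det_pos[OF S] by (simp add: c_def)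
  interpret g: prob_space "gaussian S" by (rule prob_space_gaussian[OF S])
  interpret g: product_prob_space "\<lambda>_::nat. gaussian S" ..
  have sets_N: "sets (?N K) = sets (?B K)" for K
    by (intro sets_PiM_cong) (auto simp: gaussian_def)
  have comp [measurable]: "(\<lambda>x. x i) \<in> borel_measurable (?B K)" if "i \<in> K" for i K
    using measurable_component_singleton[OF that, of "\<lambda>_. borel :: (real, 'd) vec measure"] by simp
  have W [measurable]: "?W K \<in> borel_measurable (?B L)" if "K \<subseteq> L" for K L
    using that by (intro borel_measurable_sum borel_measurable_outer comp) auto
  have T: "?T \<in> ?B (I \<union> J) \<rightarrow>\<^sub>M ?B I"
    by (intro measurable_restrict borel_measurable_matrix_vector_mult borel_measurable_matrix_mult
        borel_measurable_chol borel_measurable_chol_inv W comp) auto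
  have cols [measurable]: "?cols \<in> borel \<rightarrow>\<^sub>M ?B I"
    unfolding column_def by measurable
  have N1: "emeasure (?N K) (space (?N K)) = 1" for K
    by (intro prob_space.emeasure_space_1 prob_space_PiM prob_space_gaussian S)
  \<comment> \<open>This makes \<open>?G\<close> admissible as the normalised weight
    \<open>F\<close> in the lemmas on orthogonal parts and Gram matrices.\<close>
  have G1: "(\<integral>\<^sup>+X. ?G (X ** transpose X) \<partial>?M) = 1"
    using nn_integral_PiM_gaussian_columns[OF S e, of "\<lambda>_. 1"] N1[of I] by simp
  have Gdet: "(\<integral>\<^sup>+X. ennreal (\<bar>det X\<bar>\<^sup>2) * ?G (X ** transpose X) \<partial>?M) = ennreal c"
    using nn_integral_PiM_gaussian_columns[OF S e, of "\<lambda>x. ennreal (det (?W I x))"]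
      nn_integral_gaussian_det[OF S e]
    by (simp add: c_def sum_outer_columns[OF e] det_mul power2_eq_square cong: sum.cong)
  have GJ: "gauss_weight S (card J) w = gauss_weight S CARD('d) w / ((2 * pi) ^ CARD('d) * det S)" for w
    using pos_def_mat_det_pos[OF S] by (simp add: gauss_weight_def card)
  \<comment> \<open>Passing from \<open>d\<close> to \<open>d + 2\<close> vectors puts two more
    factors \<open>sqrt ((2 * pi) ^ d * det S)\<close> into the denominator, so the root
    disappears.\<close>
  define c2 where "c2 = ennreal (1 / ((2 * pi) ^ CARD('d) * det S))"
  have GJ': "ennreal (gauss_weight S (card J) w) = c2 * ?G w" for w
    using pos_def_mat_det_pos[OF S] by (simp add: GJ c2_def gauss_weight_nonneg flip: ennreal_mult)
  \<comment> \<open>Here the number of vectors matters: \<open>card J - CARD('d)\<close> is 2, so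
    the density is the square of \<open>det X\<close>, which is \<open>det (X X^T)\<close>, the
    weight of volume sampling.\<close>
  obtain K where K: "\<And>\<theta>. \<theta> \<in> borel_measurable borel \<Longrightarrow>
     (\<integral>\<^sup>+y. \<theta> (?W J y) \<partial>PiM J (\<lambda>_. lborel)) =
     K * (\<integral>\<^sup>+X. ennreal (\<bar>det X\<bar>\<^sup>2) * \<theta> (X ** transpose X) \<partial>?M)"
    using nn_integral_gram_eq[OF IJ(4) _ _ G1] card by auto
  have WJ [measurable]: "?W J \<in> borel_measurable (PiM J (\<lambda>_. lborel))"
    using W[of J J] by (simp cong: measurable_cong_sets sets_PiM_cong)
  have NJ: "(\<integral>\<^sup>+y. \<theta> (?W J y) \<partial>?N J) = (K * c2) * (\<integral>\<^sup>+X. ennreal (\<bar>det X\<bar>\<^sup>2) * ?G (X ** transpose X) * \<theta> (X ** transpose X) \<partial>?M)"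
    if [measurable]: "\<theta> \<in> borel_measurable borel" for \<theta>
  proof -
    have "(\<integral>\<^sup>+y. \<theta> (?W J y) \<partial>?N J) = (\<integral>\<^sup>+y. ennreal (gauss_weight S (card J) (?W J y)) * \<theta> (?W J y) \<partial>PiM J (\<lambda>_. lborel))"
      unfolding PiM_gaussian[OF S IJ(4)] by (rule nn_integral_density) measurable
    also have "\<dots> = K * (\<integral>\<^sup>+X. ennreal (\<bar>det X\<bar>\<^sup>2) * (ennreal (gauss_weight S (card J) (X ** transpose X)) * \<theta> (X ** transpose X)) \<partial>?M)"
      by (rule K) measurable
    also have "\<dots> = K * (\<integral>\<^sup>+X. c2 * (ennreal (\<bar>det X\<bar>\<^sup>2) * ?G (X ** transpose X) * \<theta> (X ** transpose X)) \<partial>?M)"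
      unfolding GJ' by (simp only: ac_simps)
    also have "\<dots> = (K * c2) * (\<integral>\<^sup>+X. ennreal (\<bar>det X\<bar>\<^sup>2) * ?G (X ** transpose X) * \<theta> (X ** transpose X) \<partial>?M)"
      by (subst nn_integral_cmult) (auto simp: mult.assoc)
    finally show ?thesis .
  qed
  \<comment> \<open>The constant function 1 as \<theta>: the left-hand side is the mass of a product
    of probability measures, and the integral on the right is \<open>c\<close> by
    \<open>Gdet\<close>.\<close>
  have "(K * c2) * ennreal c = 1"
    using NJ[of "\<lambda>_. 1"] Gdet N1[of J] by simp
  then have Kc: "K * c2 = ennreal (1 / c)"
  proof -
    assume *: "(K * c2) * ennreal c = 1"
    have "ennreal c * ennreal (1 / c) = 1"
      using c by (simp flip: ennreal_mult)
    then have "K * c2 = (K * c2) * ennreal c * ennreal (1 / c)"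
      by (simp add: mult.assoc)
    with * show ?thesis by simp
  qed
  have "distr (?N (I \<union> J)) (?B I) ?T = VS (gaussian S) S"
  proof (rule measure_eqI)
    show "sets (distr (?N (I \<union> J)) (?B I) ?T) = sets (VS (gaussian S) S)"
      using sets_N[of I] by (simp add: VS_def I_def)
    fix A assume "A \<in> sets (distr (?N (I \<union> J)) (?B I) ?T)"
    then have A [measurable]: "A \<in> sets (?B I)" by simp
    have TN: "?T \<in> ?N (I \<union> J) \<rightarrow>\<^sub>M ?B I" using T sets_N measurable_cong_sets by blast
    define h where "h X = (indicator A (?cols X) :: ennreal)" for X
    have h [measurable]: "h \<in> borel_measurable borel" unfolding h_def[abs_def] by measurable
    \<comment> \<open>\<open>\<phi> B\<close> is the probability that the columns of
      \<open>B ** transpose (orth_part Y)\<close> lie in \<open>A\<close>, where \<open>Y\<close>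
      has independent Gaussian columns. The transpose fits the right-hand side of
      \<open>nn_integral_orth_part_independent\<close>.\<close>
    define \<phi> where "\<phi> B = (\<integral>\<^sup>+Y. h (B ** transpose (orth_part Y)) * ?G (Y ** transpose Y) \<partial>?M)" for B
    have \<phi> [measurable]: "\<phi> \<in> borel_measurable borel"
      unfolding \<phi>_def[abs_def] by measurable
    have AT: "(\<lambda>z. indicator A (?T z) :: ennreal) \<in> borel_measurable (?N (I \<union> J))"
      using TN by measurable
    have T_merge: "?T (merge I J (x, y)) = (\<lambda>i\<in>I. (chol (?W J y) ** chol_inv (?W I x)) *v x i)" for x y
      using IJ(2) by (auto simp: fun_eq_iff cong: sum.cong)
    have "emeasure (distr (?N (I \<union> J)) (?B I) ?T) A = (\<integral>\<^sup>+z. indicator A (?T z) \<partial>?N (I \<union> J))"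
      using nn_integral_distr[OF TN, of "indicator A"] A by simp
    also have "\<dots> = (\<integral>\<^sup>+x. \<integral>\<^sup>+y. indicator A (?T (merge I J (x, y))) \<partial>?N J \<partial>?N I)"
      by (rule g.product_nn_integral_fold[OF IJ(2-4) AT])
    \<comment> \<open>The order is exchanged so that the vectors in \<open>J\<close> are fixed in
      the inner integral, which then depends on them only through the Cholesky factor of their Gram
      matrix.\<close>
    also have "\<dots> = (\<integral>\<^sup>+y. \<integral>\<^sup>+x. indicator A (?T (merge I J (x, y))) \<partial>?N I \<partial>?N J)"
    proof -
      interpret NI: prob_space "?N I" by (intro prob_space_PiM prob_space_gaussian S)
      interpret NJ: prob_space "?N J" by (intro prob_space_PiM prob_space_gaussian S)
      interpret pair_sigma_finite "?N J" "?N I" ..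
      show ?thesis
      proof (rule Fubini')
        have "(\<lambda>z. indicator A (?T (merge I J z)) :: ennreal) \<in> borel_measurable (?N I \<Otimes>\<^sub>M ?N J)"
          by (rule measurable_compose[OF measurable_merge AT])
        from measurable_compose[OF measurable_pair_swap' this]
        show "(\<lambda>(y, x). indicator A (?T (merge I J (x, y))) :: ennreal) \<in> borel_measurable (?N J \<Otimes>\<^sub>M ?N I)"
          by (simp add: case_prod_beta')
      qed
    qed
    also have "\<dots> = (\<integral>\<^sup>+y. \<phi> (chol (?W J y)) \<partial>?N J)"
    proof (rule nn_integral_cong)
      fix y :: "nat \<Rightarrow> (real, 'd) vec"
      let ?C = "chol (?W J y)"
      have WI: "?W I (?cols X) = X ** transpose X" for X
        by (simp add: sum_outer_columns[OF e] cong: sum.cong)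
      have Tc: "(\<lambda>i\<in>I. (?C ** chol_inv (?W I (?cols X))) *v ?cols X i) = ?cols (?C ** orth_part X)" for X
      proof -
        have "(?C ** chol_inv (?W I (?cols X))) *v column j X = column j (?C ** orth_part X)" for j
          unfolding WI by (simp add: orth_part_def matrix_mul_assoc column_matrix_mult)
        then show ?thesis by (auto simp: fun_eq_iff)
      qed
      have "(\<integral>\<^sup>+x. indicator A (?T (merge I J (x, y))) \<partial>?N I)
          = (\<integral>\<^sup>+x. indicator A (\<lambda>i\<in>I. (?C ** chol_inv (?W I x)) *v x i) \<partial>?N I)"
        by (simp only: T_merge)
      also have "\<dots> = (\<integral>\<^sup>+X. indicator A (\<lambda>i\<in>I. (?C ** chol_inv (?W I (?cols X))) *v ?cols X i) * ?G (X ** transpose X) \<partial>?M)"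
      proof (rule nn_integral_PiM_gaussian_columns[OF S e])
        have "(\<lambda>x. \<lambda>i\<in>I. (?C ** chol_inv (?W I x)) *v x i) \<in> ?B I \<rightarrow>\<^sub>M ?B I"
          by (intro measurable_restrict borel_measurable_matrix_vector_mult borel_measurable_matrix_mult
            borel_measurable_chol_inv W comp) auto
        then show "(\<lambda>x. indicator A (\<lambda>i\<in>I. (?C ** chol_inv (?W I x)) *v x i) :: ennreal) \<in> borel_measurable (?B I)"
          by measurable
      qed
      also have "\<dots> = (\<integral>\<^sup>+X. h (?C ** orth_part X) * ?G (X ** transpose X) \<partial>?M)"
        unfolding Tc h_def ..
      also have "\<dots> = \<phi> ?C"
        unfolding \<phi>_def by (rule nn_integral_orth_part_transpose[OF _ _ G1]) measurable
      finally show "(\<integral>\<^sup>+x. indicator A (?T (merge I J (x, y))) \<partial>?N I) = \<phi> ?C" .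
    qed
    \<comment> \<open>The law of the Gram matrix of \<open>J\<close> is replaced by that of
      \<open>X X^T\<close> under volume sampling.\<close>
    also have "\<dots> = ennreal (1 / c) * (\<integral>\<^sup>+X. ennreal (\<bar>det X\<bar>\<^sup>2) * ?G (X ** transpose X) * \<phi> (chol (X ** transpose X)) \<partial>?M)"
      unfolding Kc[symmetric] by (rule NJ) measurable
    also have "\<dots> = (\<integral>\<^sup>+X. ennreal (1 / c) * (ennreal (\<bar>det X\<bar>\<^sup>2) * ?G (X ** transpose X) * \<phi> (chol (X ** transpose X))) \<partial>?M)"
      by (subst nn_integral_cmult) auto
    also have "\<dots> = (\<integral>\<^sup>+X. (ennreal (det (X ** transpose X) / c) * ?G (X ** transpose X)) * \<phi> (chol (X ** transpose X)) \<partial>?M)"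
    proof (rule nn_integral_cong)
      fix X :: "'d sqmat"
      have "ennreal (1 / c) * ennreal (\<bar>det X\<bar>\<^sup>2) = ennreal (det (X ** transpose X) / c)"
        using c by (simp add: det_mul power2_eq_square flip: ennreal_mult)
      then show "ennreal (1 / c) * (ennreal (\<bar>det X\<bar>\<^sup>2) * ?G (X ** transpose X) * \<phi> (chol (X ** transpose X)))
          = (ennreal (det (X ** transpose X) / c) * ?G (X ** transpose X)) * \<phi> (chol (X ** transpose X))"
        by (metis mult.assoc)
    qed
    \<comment> \<open>Independence is read backwards, with the volume sampling density as weight:
      the Cholesky factor of \<open>X X^T\<close> and the independent orthogonal part recombine to
      \<open>X\<close> itself.\<close>
    also have "\<dots> = (\<integral>\<^sup>+X. h X * (ennreal (det (X ** transpose X) / c) * ?G (X ** transpose X)) \<partial>?M)"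
      unfolding \<phi>_def
      by (rule nn_integral_orth_part_independent[OF _ _ _ G1, symmetric,
            where g = "\<lambda>w. ennreal (det w / c) * ?G w"]) measurable
    also have "\<dots> = (\<integral>\<^sup>+x. ennreal (det (?W I x) / c) * indicator A x \<partial>?N I)"
      by (subst nn_integral_PiM_gaussian_columns[OF S e])
        (auto simp: h_def sum_outer_columns[OF e] W ac_simps cong: sum.cong)
    also have "\<dots> = emeasure (VS (gaussian S) S) A"
    proof -
      have "?W I \<in> borel_measurable (?N I)"
        using W[of I I] sets_N measurable_cong_sets by blast
      then have "(\<lambda>x. ennreal (det (?W I x) / c)) \<in> borel_measurable (?N I)"
        by (rule measurable_compose) measurable
      moreover have "A \<in> sets (?N I)" using A sets_N by simp
      ultimately show ?thesis
        unfolding VS_def c_def[symmetric] I_def[symmetric] by (rule emeasure_density[symmetric])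
    qed
    finally show "emeasure (distr (?N (I \<union> J)) (?B I) ?T) A = emeasure (VS (gaussian S) S) A" .
  qed
  then show ?thesis
    unfolding IJ(1) by (simp only: I_def[symmetric] J_def[symmetric])
qed

end
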